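(* Let $(\mathcal K,d)$ be a finite metric space, let $D>1$, $\gamma\in(0,1)$ and $n\in\mathbb N$ with $\gamma D\in\{1,\dots,n\}$, and for $s\in\mathcal K^n$ and $\mathbf p\in\triangle_{|\mathcal K|}^n$ let $$U_s(\mathbf p)=\max_{1\le i\le n-\gamma D+1}\ \sum_{j=i}^{i+\gamma D-1}\big(1-\langle\mathbf s_{[j]},\mathbf p_{[j]}\rangle\big).$$ Let $\mathbb S^{a\times b}$ be the set of $a\times b$ nonnegative matrices whose columns have unit $\ell_1$-norm. 1. There is a polynomial-time algorithm such that for all $\delta,\varepsilon>0$ and every distribution $\mathcal D$ over request sequences $s\in\mathcal K^n$ and associated feature sequences $\mathbf F$ with $\mathbf F^\top\in\mathbb S^{f\times n}$, it takes $O\big((\tfrac{\gamma D}\varepsilon)^2(n^2f^2\log|\mathcal K|+\log\tfrac1\delta)\big)$ i.i.d. samples from $\mathcal D$ and returns $\hat{\mathbf A}$ such that with probability at least $1-\delta$ $$\mathbb E_{(s,\mathbf F)\sim\mathcal D}U_s(\mathbf F\hat{\mathbf A}^\top)\le\min_{\mathbf A\in\mathbb S^{|\mathcal K|\times f}}\mathbb E_{(s,\mathbf F)\sim\mathcal D}U_s(\mathbf F\mathbf A^\top)+\varepsilon.$$ 2. Let $(s_1,\mathbf F_1),\dots,(s_T,\mathbf F_T)$ be any (adversarial) sequence of (request sequence, feature sequence) pairs, with $s_t\in\mathcal K^n$ and $\mathbf F_t^\top\in\mathbb S^{f\times n}$. Then updating, for each column $k\in[f]$, the distribution $\mathbf A_{t[\cdot,k]}\in\triangle_{|\mathcal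 K|}$ using exponentiated gradient (EG) with appropriate step-size on the losses $\mathbf A\mapsto U_{s_t}(\mathbf F_t\mathbf A^\top)$ has regret $$\max_{\mathbf A\in\mathbb S^{|\mathcal K|\times f}}\sum_{t=1}^T\big(U_{s_t}(\mathbf F_t\mathbf A_t^\top)-U_{s_t}(\mathbf F_t\mathbf A^\top)\big)\le\gamma Df\sqrt{2T\log|\mathcal K|}.$$
   Context: $\triangle_k$ is the probability simplex in $\mathbb R^k$; coordinates of $\mathbb R^{|\mathcal K|}$ are indexed by $\mathcal K$; $\mathbf p=(\mathbf p_{[1]},\dots,\mathbf p_{[n]})\in\triangle_{|\mathcal K|}^n$ is identified with the $n\times|\mathcal K|$ matrix with rows $\mathbf p_{[j]}$, so $\mathbf F\mathbf A^\top\in\triangle_{|\mathcal K|}^n$ for $\mathbf F^\top\in\mathbb S^{f\times n}$, $\mathbf A\in\mathbb S^{|\mathcal K|\times f}$; $\mathbf s_{[j]}\in\{0,1\}^{|\mathcal K|}$ is the one-hot encoding of $s_{[j]}$. EG with step-size $\alpha>0$: every column $\mathbf A_{1[\cdot,k]}$ is initialized to the uniform distribution, and after observing the loss, each entry of $\mathbf A_t$ is multiplied by $\exp(-\alpha g)$, where $g$ is the corresponding entry of a subgradient of $\mathbf A\mapsto U_{s_t}(\mathbf F_t\mathbf A^\top)$ (viewed as a function on all of $\mathbb R^{|\mathcal K|\times f}$) at $\mathbf A_t$, and each column is renormalized to sum to one. "With appropriate step-size" means that there is a choice of $\alpha$ (depending on $T$ and the problem parameters) for which the inequality holds. Constants in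 $O(\cdot)$ are universal; the sample-complexity bound is understood in the usual asymptotic sense as $\varepsilon,\delta\to0$ (e.g. $\delta\le1/2$, at least one sample). *)

theory Defs
  imports "HOL-Probability.Probability"
begin

text \<open>
  Matrices and sequences of fixed length are functions that are only inspected on their index
  sets. Coordinates of \<open>\<real>\<^sup>|\<^sup>K\<^sup>|\<close> are indexed by the points of \<open>K\<close> themselves; the index set
  written \<open>[n]\<close> in mathematics is \<open>{..<n}\<close>. The quantity \<open>\<gamma> * D\<close> is a natural number, and
  \<open>w\<close> always denotes that number.
\<close>

definition setting :: "'k set \<Rightarrow> ('k \<Rightarrow> 'k \<Rightarrow> real) \<Rightarrow> real \<Rightarrow> real \<Rightarrow> nat \<Rightarrow> nat \<Rightarrow> bool" where
  "setting K d D \<gamma> w n \<longleftrightarrow>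
     Metric_space K d \<and> finite K \<and> K \<noteq> {} \<and>
     D > 1 \<and> 0 < \<gamma> \<and> \<gamma> < 1 \<and> real w = \<gamma> * D \<and> w \<in> {1..n}"

text \<open>The set \<open>\<S>\<^sup>a\<^sup>\<times>\<^sup>b\<close>, with row index set \<open>R\<close> and column index set \<open>C\<close>.\<close>

definition stoch :: "'r set \<Rightarrow> 'c set \<Rightarrow> ('r \<Rightarrow> 'c \<Rightarrow> real) set" where
  "stoch R C = {M. (\<forall>i\<in>R. \<forall>j\<in>C. 0 \<le> M i j) \<and> (\<forall>j\<in>C. (\<Sum>i\<in>R. M i j) = 1)}"

definition transpose_fun :: "('r \<Rightarrow> 'c \<Rightarrow> real) \<Rightarrow> 'c \<Rightarrow> 'r \<Rightarrow> real" where
  "transpose_fun M = (\<lambda>j i. M i j)"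

definition mat_prod :: "'m set \<Rightarrow> ('r \<Rightarrow> 'm \<Rightarrow> real) \<Rightarrow> ('m \<Rightarrow> 'c \<Rightarrow> real) \<Rightarrow> 'r \<Rightarrow> 'c \<Rightarrow> real" where
  "mat_prod I M N = (\<lambda>i j. \<Sum>l\<in>I. M i l * N l j)"

definition predict :: "nat \<Rightarrow> (nat \<Rightarrow> nat \<Rightarrow> real) \<Rightarrow> ('k \<Rightarrow> nat \<Rightarrow> real) \<Rightarrow> nat \<Rightarrow> 'k \<Rightarrow> real" where
  "predict f F A = mat_prod {..<f} F (transpose_fun A)"

definition one_hot :: "'k \<Rightarrow> 'k \<Rightarrow> real" where
  "one_hot x = (\<lambda>a. if a = x then 1 else 0)"

definition U :: "'k set \<Rightarrow> nat \<Rightarrow> nat \<Rightarrow> (nat \<Rightarrow> 'k) \<Rightarrow> (nat \<Rightarrow> 'k \<Rightarrow> real) \<Rightarrow> real" where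
  "U K w n s p =
     Max ((\<lambda>i. \<Sum>j\<in>{i..<i + w}. (1 - (\<Sum>a\<in>K. one_hot (s j) a * p j a))) ` {0..n - w})"


section \<open>Exponentiated gradient\<close>

definition is_subgradient ::
  "'k set \<Rightarrow> nat \<Rightarrow> (('k \<Rightarrow> nat \<Rightarrow> real) \<Rightarrow> real) \<Rightarrow> ('k \<Rightarrow> nat \<Rightarrow> real) \<Rightarrow> ('k \<Rightarrow> nat \<Rightarrow> real) \<Rightarrow> bool" where
  "is_subgradient K f h A g \<longleftrightarrow>
     (\<forall>B. h B \<ge> h A + (\<Sum>a\<in>K. \<Sum>k<f. g a k * (B a k - A a k)))"

text \<open>
  \<open>eg \<alpha> K g t\<close> is the iterate after \<open>t\<close> updates, where \<open>g t\<close> is the (sub)gradient fed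
  to update number \<open>t\<close>.
\<close>

primrec eg :: "real \<Rightarrow> 'k set \<Rightarrow> (nat \<Rightarrow> 'k \<Rightarrow> nat \<Rightarrow> real) \<Rightarrow> nat \<Rightarrow> 'k \<Rightarrow> nat \<Rightarrow> real" where
  "eg \<alpha> K g 0 = (\<lambda>a k. 1 / real (card K))"
| "eg \<alpha> K g (Suc t) =
     (\<lambda>a k. eg \<alpha> K g t a k * exp (- \<alpha> * g t a k) /
             (\<Sum>b\<in>K. eg \<alpha> K g t b k * exp (- \<alpha> * g t b k)))"

definition regret ::
  "'k set \<Rightarrow> nat \<Rightarrow> nat \<Rightarrow> nat \<Rightarrow> nat \<Rightarrow> (nat \<Rightarrow> nat \<Rightarrow> 'k) \<Rightarrow> (nat \<Rightarrow> nat \<Rightarrow> nat \<Rightarrow> real) \<Rightarrow>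
   (nat \<Rightarrow> 'k \<Rightarrow> nat \<Rightarrow> real) \<Rightarrow> ('k \<Rightarrow> nat \<Rightarrow> real) \<Rightarrow> real" where
  "regret K w n f T s F A B =
     (\<Sum>t<T. U K w n (s t) (predict f (F t) (A t)) - U K w n (s t) (predict f (F t) B))"


section \<open>Distributions over request and feature sequences\<close>

type_synonym 'k sample = "(nat \<Rightarrow> 'k) \<times> (nat \<Rightarrow> nat \<Rightarrow> real)"

text \<open>
  The Borel space of all pairs of a request sequence in \<open>K\<^sup>n\<close> and a real \<open>n \<times> f\<close> matrix \<open>F\<close>
  with \<open>F\<^sup>T \<in> \<S>\<^sup>f\<^sup>\<times>\<^sup>n\<close>.
\<close>

definition sample_space :: "'k set \<Rightarrow> nat \<Rightarrow> nat \<Rightarrow> 'k sample measure" where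
  "sample_space K n f =
     restrict_space
       ((\<Pi>\<^sub>M j\<in>{..<n}. count_space K) \<Otimes>\<^sub>M (\<Pi>\<^sub>M j\<in>{..<n}. \<Pi>\<^sub>M k\<in>{..<f}. (borel :: real measure)))
       {(s, F). transpose_fun F \<in> stoch {..<f} {..<n}}"

definition risk ::
  "'k set \<Rightarrow> nat \<Rightarrow> nat \<Rightarrow> nat \<Rightarrow> 'k sample measure \<Rightarrow> ('k \<Rightarrow> nat \<Rightarrow> real) \<Rightarrow> real" where
  "risk K w n f \<D> A = (\<integral>(s, F). U K w n s (predict f F A) \<partial>\<D>)"


section \<open>A real random access machine\<close>

text \<open>
  Since the features are arbitrary reals, running time is measured on a real RAM (the
  Blum--Shub--Smale model with random access): the store has arrays of natural numbers and arrays
  of reals, each addressed by a name and a list of natural numbers, and scalars are the cells with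
  the empty address. Real arithmetic is restricted to field operations and comparisons, and the
  only constants are natural numbers. In particular there are no roots, exponentials, logarithms
  or roundings, and no conversion from reals to naturals. On naturals there is no multiplication,
  so that the bit length of every natural grows by at most a constant per step.
\<close>

type_synonym state = "(string \<Rightarrow> nat list \<Rightarrow> nat) \<times> (string \<Rightarrow> nat list \<Rightarrow> real)"

datatype nexp =
    NConst nat
  | NCell string "nexp list"
  | NPlus nexp nexp
  | NMinus nexp nexp

datatype rexp =
    RNat nexp
  | RCell string "nexp list"
  | RPlus rexp rexp
  | RMinus rexp rexp
  | RTimes rexp rexp
  | RDivide rexp rexp

datatype bexp =
    NLess nexp nexp
  | RLess rexp rexp
  | BNot bexp
  | BAnd bexp bexp

datatype com =
    Skip
  | NAssign string "nexp list" nexp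
  | RAssign string "nexp list" rexp
  | Seq com com
  | If bexp com com
  | While bexp com

primrec nval :: "state \<Rightarrow> nexp \<Rightarrow> nat" where
  "nval \<sigma> (NConst c) = c"
| "nval \<sigma> (NCell x is) = fst \<sigma> x (map (nval \<sigma>) is)"
| "nval \<sigma> (NPlus a b) = nval \<sigma> a + nval \<sigma> b"
| "nval \<sigma> (NMinus a b) = nval \<sigma> a - nval \<sigma> b"

primrec rval :: "state \<Rightarrow> rexp \<Rightarrow> real" where
  "rval \<sigma> (RNat a) = real (nval \<sigma> a)"
| "rval \<sigma> (RCell x is) = snd \<sigma> x (map (nval \<sigma>) is)"
| "rval \<sigma> (RPlus a b) = rval \<sigma> a + rval \<sigma> b"
| "rval \<sigma> (RMinus a b) = rval \<sigma> a - rval \<sigma> b"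
| "rval \<sigma> (RTimes a b) = rval \<sigma> a * rval \<sigma> b"
| "rval \<sigma> (RDivide a b) = rval \<sigma> a / rval \<sigma> b"

primrec bval :: "state \<Rightarrow> bexp \<Rightarrow> bool" where
  "bval \<sigma> (NLess a b) \<longleftrightarrow> nval \<sigma> a < nval \<sigma> b"
| "bval \<sigma> (RLess a b) \<longleftrightarrow> rval \<sigma> a < rval \<sigma> b"
| "bval \<sigma> (BNot b) \<longleftrightarrow> \<not> bval \<sigma> b"
| "bval \<sigma> (BAnd b c) \<longleftrightarrow> bval \<sigma> b \<and> bval \<sigma> c"

definition upd :: "(string \<Rightarrow> nat list \<Rightarrow> 'v) \<Rightarrow> string \<Rightarrow> nat list \<Rightarrow> 'v \<Rightarrow> string \<Rightarrow> nat list \<Rightarrow> 'v" where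
  "upd \<sigma> x is v = \<sigma>(x := (\<sigma> x)(is := v))"

text \<open>
  \<open>exec c \<sigma> t \<sigma>'\<close>: started in \<open>\<sigma>\<close>, the program \<open>c\<close> halts in \<open>\<sigma>'\<close> after \<open>t\<close> steps. Each
  assignment and each test costs one step; the expressions occurring in a fixed program have
  bounded size, so counting every arithmetic operation separately changes \<open>t\<close> by at most a
  factor that depends on the program only.
\<close>

inductive exec :: "com \<Rightarrow> state \<Rightarrow> nat \<Rightarrow> state \<Rightarrow> bool" where
  exec_Skip: "exec Skip \<sigma> 1 \<sigma>"
| exec_NAssign:
    "exec (NAssign x is a) \<sigma> 1 (upd (fst \<sigma>) x (map (nval \<sigma>) is) (nval \<sigma> a), snd \<sigma>)"
| exec_RAssign:
    "exec (RAssign x is a) \<sigma> 1 (fst \<sigma>, upd (snd \<sigma>) x (map (nval \<sigma>) is) (rval \<sigma> a))"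
| exec_Seq: "exec c1 \<sigma> t1 \<sigma>' \<Longrightarrow> exec c2 \<sigma>' t2 \<sigma>'' \<Longrightarrow> exec (Seq c1 c2) \<sigma> (t1 + t2) \<sigma>''"
| exec_IfTrue: "bval \<sigma> b \<Longrightarrow> exec c1 \<sigma> t \<sigma>' \<Longrightarrow> exec (If b c1 c2) \<sigma> (t + 1) \<sigma>'"
| exec_IfFalse: "\<not> bval \<sigma> b \<Longrightarrow> exec c2 \<sigma> t \<sigma>' \<Longrightarrow> exec (If b c1 c2) \<sigma> (t + 1) \<sigma>'"
| exec_WhileFalse: "\<not> bval \<sigma> b \<Longrightarrow> exec (While b c) \<sigma> 1 \<sigma>"
| exec_WhileTrue:
    "bval \<sigma> b \<Longrightarrow> exec c \<sigma> t1 \<sigma>' \<Longrightarrow> exec (While b c) \<sigma>' t2 \<sigma>'' \<Longrightarrow>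
     exec (While b c) \<sigma> (t1 + t2 + 1) \<sigma>''"

inductive_cases exec_SkipE: "exec Skip \<sigma> t \<sigma>'"
inductive_cases exec_NAssignE: "exec (NAssign x is a) \<sigma> t \<sigma>'"
inductive_cases exec_RAssignE: "exec (RAssign x is a) \<sigma> t \<sigma>'"
inductive_cases exec_SeqE: "exec (Seq c1 c2) \<sigma> t \<sigma>'"
inductive_cases exec_IfE: "exec (If b c1 c2) \<sigma> t \<sigma>'"
inductive_cases exec_WhileE: "exec (While b c) \<sigma> t \<sigma>'"

lemma exec_deterministic:
  "exec c \<sigma> t \<sigma>' \<Longrightarrow> exec c \<sigma> u \<tau> \<Longrightarrow> t = u \<and> \<sigma>' = \<tau>"
proof (induction arbitrary: u \<tau> rule: exec.induct)
  case (exec_Skip \<sigma>)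
  then show ?case by (auto elim: exec_SkipE)
next
  case exec_NAssign
  then show ?case by (auto elim: exec_NAssignE)
next
  case exec_RAssign
  then show ?case by (auto elim: exec_RAssignE)
next
  case (exec_Seq c1 \<sigma> t1 \<sigma>' c2 t2 \<sigma>'')
  from exec_Seq.prems obtain u1 u2 \<tau>' where
    *: "u = u1 + u2" "exec c1 \<sigma> u1 \<tau>'" "exec c2 \<tau>' u2 \<tau>"
    by (rule exec_SeqE)
  from exec_Seq.IH(1)[OF *(2)] exec_Seq.IH(2)[of u2 \<tau>] * show ?case by simp
next
  case (exec_IfTrue \<sigma> b c1 t \<sigma>' c2)
  from exec_IfTrue.prems exec_IfTrue.hyps(1) obtain u1 where
    "u = u1 + 1" "exec c1 \<sigma> u1 \<tau>"
    by (elim exec_IfE) simp_all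
  with exec_IfTrue.IH[of u1 \<tau>] show ?case by simp
next
  case (exec_IfFalse \<sigma> b c2 t \<sigma>' c1)
  from exec_IfFalse.prems exec_IfFalse.hyps(1) obtain u1 where
    "u = u1 + 1" "exec c2 \<sigma> u1 \<tau>"
    by (elim exec_IfE) simp_all
  with exec_IfFalse.IH[of u1 \<tau>] show ?case by simp
next
  case (exec_WhileFalse \<sigma> b c)
  show ?case
    by (rule exec_WhileE[OF exec_WhileFalse.prems]) (use exec_WhileFalse.hyps in simp_all)
next
  case (exec_WhileTrue \<sigma> b c t1 \<sigma>' t2 \<sigma>'')
  obtain u1 u2 \<tau>' where
    *: "u = u1 + u2 + 1" "exec c \<sigma> u1 \<tau>'" "exec (While b c) \<tau>' u2 \<tau>"
    by (rule exec_WhileE[OF exec_WhileTrue.prems]) (use exec_WhileTrue.hyps(1) in auto)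
  from exec_WhileTrue.IH(1)[OF *(2)] exec_WhileTrue.IH(2)[of u2 \<tau>] * show ?case by simp
qed

text \<open>
  The input of a learning algorithm: the problem dimensions, the accuracy and confidence
  parameters, and \<open>m\<close> samples \<open>z 0, \<dots>, z (m - 1)\<close>. The points of \<open>K\<close> are represented by their
  numbers under a bijection \<open>idx\<close> from \<open>K\<close> to \<open>{..<card K}\<close>. All other cells are \<open>0\<close>.
\<close>

definition input_state ::
  "'k set \<Rightarrow> ('k \<Rightarrow> nat) \<Rightarrow> nat \<Rightarrow> nat \<Rightarrow> nat \<Rightarrow> real \<Rightarrow> real \<Rightarrow> nat \<Rightarrow> (nat \<Rightarrow> 'k sample) \<Rightarrow> state" where
  "input_state K idx w n f \<epsilon> \<delta> m z =
    (\<lambda>x is. case is of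
        [] \<Rightarrow> if x = ''K'' then card K
              else if x = ''w'' then w
              else if x = ''n'' then n
              else if x = ''f'' then f
              else if x = ''m'' then m
              else 0
      | [i, j] \<Rightarrow> if x = ''s'' \<and> i < m \<and> j < n then idx (fst (z i) j) else 0
      | _ \<Rightarrow> 0,
     \<lambda>x is. case is of
        [] \<Rightarrow> if x = ''eps'' then \<epsilon> else if x = ''delta'' then \<delta> else 0
      | [i, j, k] \<Rightarrow> if x = ''F'' \<and> i < m \<and> j < n \<and> k < f then snd (z i) j k else 0
      | _ \<Rightarrow> 0)"

definition output_matrix :: "('k \<Rightarrow> nat) \<Rightarrow> state \<Rightarrow> 'k \<Rightarrow> nat \<Rightarrow> real" where
  "output_matrix idx \<sigma> = (\<lambda>a k. snd \<sigma> ''A'' [idx a, k])"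

text \<open>At least one sample is always drawn, also when the logarithmic term vanishes.\<close>

definition sample_size :: "real \<Rightarrow> real \<Rightarrow> real \<Rightarrow> nat \<Rightarrow> nat \<Rightarrow> nat \<Rightarrow> real \<Rightarrow> real \<Rightarrow> nat" where
  "sample_size C \<gamma> D n f N \<epsilon> \<delta> =
     max 1 (nat \<lceil>C * ((\<gamma> * D / \<epsilon>)\<^sup>2 * ((real n)\<^sup>2 * (real f)\<^sup>2 * ln (real N) + ln (1 / \<delta>)))\<rceil>)"

end

theory Submission
  imports Defs
begin

text \<open>
  Writing \<open>U\<close> as \<open>w\<close> minus the smallest window score, a worst window gives a linear minorant of the
  loss whose slope in column \<open>k\<close> is minus a gain vector with entries in \<open>[0, w]\<close>. Hence the regret
  splits into \<open>f\<close> expert problems, one per column, and any update with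
  \<open>ln p' \<ge> ln p + \<eta> (v - \<langle>p, v\<rangle>) - \<eta>\<^sup>2 w\<^sup>2 / 2\<close> has regret at most \<open>ln |K| / \<eta> + \<eta> T w\<^sup>2 / 2\<close> in each
  of them. EG satisfies this for arbitrary subgradients, since perturbing a single entry shows that
  their entries lie in \<open>[-w, 0]\<close>.

  The learner has no exponentials or roots at its disposal. It uses the linear update
  \<open>p' \<propto> p (1 + \<eta> v)\<close>, which satisfies the same inequality without a restriction on \<open>\<eta>\<close> because gains
  are nonnegative, with the rational step size \<open>\<eta> = \<epsilon> / (2 f w\<^sup>2)\<close>, and returns the average of its
  iterates. By convexity, the excess risk of the average is at most the average regret plus the
  average of a martingale difference sequence, which the Azuma--Hoeffding inequality controls.
\<close>

section \<open>Scores, losses and multiplicative updates\<close>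

text \<open>Each sample is processed exactly once, so iterate \<open>t\<close> is independent of
  sample \<open>t\<close>, and its loss there is an unbiased estimate of its risk. This takes the
  place of a deviation bound that is uniform over all stochastic matrices: only the iterates and one
  fixed minimizer of the risk are compared with their empirical losses, and a single martingale
  carries both. The error \<epsilon> is spent as \<epsilon>/4 on each of the two regret terms and
  \<epsilon>/2 on the deviation. The martingale differences are bounded by \<open>2 * w\<close>, so
  the deviation has probability at most
  \<open>exp (- m * \<epsilon>\<^sup>2 / (32 * w\<^sup>2))\<close>, which is the origin of the
  constant 32. A matrix is a total function, while \<open>stoch\<close> constrains only the entries
  on the index set. The Lipschitz bound for the loss, whose right-hand side sees only those entries,
  bridges this gap wherever minima are attained or matrices are exchanged.\<close>

definition score :: "nat \<Rightarrow> nat \<Rightarrow> 'k sample \<Rightarrow> ('k \<Rightarrow> nat \<Rightarrow> real) \<Rightarrow> nat \<Rightarrow> real" where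
  "score f w x A i = (\<Sum>j\<in>{i..<i + w}. \<Sum>l<f. snd x j l * A (fst x j) l)"

text \<open>The gradient of \<open>score f w x A i\<close> in \<open>A\<close>, independent of
  \<open>A\<close> because the score is linear.\<close>

definition gain :: "nat \<Rightarrow> 'k sample \<Rightarrow> nat \<Rightarrow> 'k \<Rightarrow> nat \<Rightarrow> real" where
  "gain w x i a k = (\<Sum>j\<in>{i..<i + w}. if fst x j = a then snd x j k else 0)"

abbreviation loss :: "'k set \<Rightarrow> nat \<Rightarrow> nat \<Rightarrow> nat \<Rightarrow> 'k sample \<Rightarrow> ('k \<Rightarrow> nat \<Rightarrow> real) \<Rightarrow> real" where
  "loss K w n f x A \<equiv> U K w n (fst x) (predict f (snd x) A)"

text \<open>Constrains the values on the index ranges only, without extensionality, so that it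
  covers both the points of \<open>sample_space\<close> and the adversarial pairs of the second
  claim.\<close>

definition valid_sample :: "'k set \<Rightarrow> nat \<Rightarrow> nat \<Rightarrow> 'k sample \<Rightarrow> bool" where
  "valid_sample K n f x \<longleftrightarrow> fst x \<in> {..<n} \<rightarrow> K \<and> transpose_fun (snd x) \<in> stoch {..<f} {..<n}"

lemma valid_sampleD:
  assumes "valid_sample K n f x" "j < n"
  shows "fst x j \<in> K" "k < f \<Longrightarrow> 0 \<le> snd x j k" "(\<Sum>k<f. snd x j k) = 1" "k < f \<Longrightarrow> snd x j k \<le> 1"
proof -
  show "fst x j \<in> K" using assms by (auto simp: valid_sample_def)
  show nonneg: "0 \<le> snd x j k" if "k < f" for k
    using assms that by (auto simp: valid_sample_def stoch_def transpose_fun_def)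
  show sum1: "(\<Sum>k<f. snd x j k) = 1"
    using assms by (auto simp: valid_sample_def stoch_def transpose_fun_def)
  show "snd x j k \<le> 1" if "k < f"
    using member_le_sum[of k "{..<f}" "snd x j"] nonneg that sum1 by auto
qed

lemma stochD:
  assumes "A \<in> stoch K C" "k \<in> C"
  shows "a \<in> K \<Longrightarrow> 0 \<le> A a k" "(\<Sum>a\<in>K. A a k) = 1" "finite K \<Longrightarrow> a \<in> K \<Longrightarrow> A a k \<le> 1"
  using assms member_le_sum[of a K "\<lambda>a. A a k"] by (auto simp: stoch_def)

lemma gain_bounds:
  assumes "valid_sample K n f x" "i + w \<le> n" "k < f"
  shows "0 \<le> gain w x i a k" "gain w x i a k \<le> real w"
proof -
  show "0 \<le> gain w x i a k"
    unfolding gain_def using assms by (intro sum_nonneg) (auto intro!: valid_sampleD(2))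
  have "gain w x i a k \<le> (\<Sum>j\<in>{i..<i + w}. 1)"
    unfolding gain_def using assms
    by (intro sum_mono) (auto intro!: valid_sampleD(4))
  then show "gain w x i a k \<le> real w" by simp
qed

text \<open>The positions of the window are grouped by the point requested there. Validity puts
  every request into \<open>K\<close>, so each position falls into exactly one group.\<close>

lemma score_eq_gain:
  assumes "valid_sample K n f x" "finite K" "i + w \<le> n"
  shows "score f w x A i = (\<Sum>k<f. \<Sum>a\<in>K. gain w x i a k * A a k)"
proof -
  have "(\<Sum>k<f. \<Sum>a\<in>K. gain w x i a k * A a k) =
    (\<Sum>k<f. \<Sum>j\<in>{i..<i + w}. \<Sum>a\<in>K. if fst x j = a then snd x j k * A a k else 0)"
    unfolding gain_def sum_distrib_right
    by (intro sum.cong refl, subst sum.swap) (auto intro!: sum.cong)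
  also have "\<dots> = (\<Sum>k<f. \<Sum>j\<in>{i..<i + w}. snd x j k * A (fst x j) k)"
    using assms by (intro sum.cong refl) (auto simp: sum.delta' valid_sampleD(1))
  also have "\<dots> = score f w x A i"
    unfolding score_def by (rule sum.swap)
  finally show ?thesis by simp
qed

lemma loss_eq_Max_score:
  assumes "valid_sample K n f x" "finite K" "w \<le> n"
  shows "loss K w n f x A = Max ((\<lambda>i. real w - score f w x A i) ` {0..n - w})"
proof -
  have "(\<Sum>j\<in>{i..<i + w}. 1 - (\<Sum>a\<in>K. one_hot (fst x j) a * predict f (snd x) A j a))
     = real w - score f w x A i" if "i \<in> {0..n - w}" for i
  proof -
    have "(\<Sum>a\<in>K. one_hot (fst x j) a * predict f (snd x) A j a) = (\<Sum>l<f. snd x j l * A (fst x j) l)"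
      if "j \<in> {i..<i + w}" for j
    proof -
      have "fst x j \<in> K" using that \<open>i \<in> _\<close> assms by (auto intro!: valid_sampleD(1))
      then show ?thesis
        using assms(2)
        by (simp add: one_hot_def predict_def mat_prod_def transpose_fun_def if_distrib[of "\<lambda>u. u * _"] cong: if_cong)
    qed
    then show ?thesis by (simp add: score_def sum_subtractf)
  qed
  then show ?thesis unfolding U_def by (intro arg_cong[where f = Max] image_cong) auto
qed

text \<open>Every window gives an affine minorant of the loss, and \<open>loss_attained\<close>
  provides a tight one. Together they stand in for the maximum in the later inequalities.\<close>

lemma loss_ge_score:
  assumes "valid_sample K n f x" "finite K" "w \<le> n" "i \<le> n - w"
  shows "real w - score f w x A i \<le> loss K w n f x A"
  unfolding loss_eq_Max_score[OF assms(1-3)] using assms(4) by (intro Max_ge) auto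

lemma loss_attained:
  assumes "valid_sample K n f x" "finite K" "w \<le> n"
  obtains i where "i \<le> n - w" "loss K w n f x A = real w - score f w x A i"
proof -
  have "Max ((\<lambda>i. real w - score f w x A i) ` {0..n - w}) \<in> (\<lambda>i. real w - score f w x A i) ` {0..n - w}"
    by (intro Max_in) auto
  then have "loss K w n f x A \<in> (\<lambda>i. real w - score f w x A i) ` {0..n - w}"
    by (simp only: loss_eq_Max_score[OF assms])
  then show ?thesis using that by auto
qed

lemma score_bounds:
  assumes "valid_sample K n f x" "finite K" "i + w \<le> n" "A \<in> stoch K {..<f}"
  shows "0 \<le> score f w x A i" "score f w x A i \<le> real w"
proof -
  have *: "0 \<le> (\<Sum>l<f. snd x j l * A (fst x j) l) \<and> (\<Sum>l<f. snd x j l * A (fst x j) l) \<le> 1"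
    if "j \<in> {i..<i + w}" for j
  proof -
    have j: "j < n" using that assms by auto
    note D = valid_sampleD[OF assms(1) j]
    have "(\<Sum>l<f. snd x j l * A (fst x j) l) \<le> (\<Sum>l<f. snd x j l * 1)"
      using D assms by (intro sum_mono mult_left_mono) (auto intro!: stochD(3)[OF assms(4)])
    then show ?thesis
      using D by (auto intro!: sum_nonneg mult_nonneg_nonneg stochD(1)[OF assms(4)])
  qed
  show "0 \<le> score f w x A i" unfolding score_def using * by (intro sum_nonneg[of "{i..<i+w}"]) blast
  have "score f w x A i \<le> (\<Sum>j\<in>{i..<i + w}. 1)" unfolding score_def using * by (intro sum_mono) auto
  then show "score f w x A i \<le> real w" by simp
qed

lemma loss_bounds:
  assumes "valid_sample K n f x" "finite K" "w \<le> n" "A \<in> stoch K {..<f}"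
  shows "0 \<le> loss K w n f x A" "loss K w n f x A \<le> real w"
proof -
  obtain i where "i \<le> n - w" "loss K w n f x A = real w - score f w x A i"
    using loss_attained assms by blast
  then show "0 \<le> loss K w n f x A" "loss K w n f x A \<le> real w"
    using score_bounds[of K n f x i w A] assms by auto
qed

text \<open>A window that is worst for one matrix is evaluated at the other as well, and gains lie
  in \<open>[0, w]\<close>. The bound also shows that the loss ignores all entries outside
  \<open>K\<close> and \<open>{..<f}\<close>.\<close>

lemma loss_lipschitz:
  assumes "valid_sample K n f x" "finite K" "w \<le> n"
  shows "\<bar>loss K w n f x A - loss K w n f x B\<bar> \<le> real w * (\<Sum>k<f. \<Sum>a\<in>K. \<bar>A a k - B a k\<bar>)"
proof -
  have *: "loss K w n f x A - loss K w n f x B \<le> real w * (\<Sum>k<f. \<Sum>a\<in>K. \<bar>A a k - B a k\<bar>)" for A B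
  proof -
    obtain i where i: "i \<le> n - w" "loss K w n f x A = real w - score f w x A i"
      using loss_attained assms by blast
    have iw: "i + w \<le> n" using i assms by auto
    have "loss K w n f x A - loss K w n f x B \<le> score f w x B i - score f w x A i"
      using loss_ge_score[OF assms i(1), of B] i by simp
    also have "\<dots> = (\<Sum>k<f. \<Sum>a\<in>K. gain w x i a k * (B a k - A a k))"
      by (simp add: score_eq_gain[OF assms(1,2) iw] sum_subtractf algebra_simps)
    also have "\<dots> \<le> (\<Sum>k<f. \<Sum>a\<in>K. real w * \<bar>A a k - B a k\<bar>)"
    proof (intro sum_mono)
      fix k a assume "k \<in> {..<f}"
      then have g: "0 \<le> gain w x i a k" "gain w x i a k \<le> real w"
        using gain_bounds[OF assms(1) iw] by auto
      have "gain w x i a k * (B a k - A a k) \<le> gain w x i a k * \<bar>A a k - B a k\<bar>"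
        using g by (intro mult_left_mono) auto
      also have "\<dots> \<le> real w * \<bar>A a k - B a k\<bar>" using g by (intro mult_right_mono) auto
      finally show "gain w x i a k * (B a k - A a k) \<le> real w * \<bar>A a k - B a k\<bar>" .
    qed
    finally show ?thesis by (simp add: sum_distrib_left)
  qed
  have "(\<Sum>k<f. \<Sum>a\<in>K. \<bar>A a k - B a k\<bar>) = (\<Sum>k<f. \<Sum>a\<in>K. \<bar>B a k - A a k\<bar>)"
    by (simp add: abs_minus_commute)
  then show ?thesis using *[of A B] *[of B A] by (simp add: abs_le_iff)
qed

text \<open>Jensen's inequality: the window that is worst for the average is an affine minorant at
  every \<open>B t\<close>.\<close>

lemma loss_average_le:
  assumes "valid_sample K n f x" "finite K" "w \<le> n" "m > 0"
    and A: "\<And>a k. a \<in> K \<Longrightarrow> k < f \<Longrightarrow> A a k = (\<Sum>t<m. B t a k) / real m"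
  shows "loss K w n f x A \<le> (\<Sum>t<m. loss K w n f x (B t)) / real m"
proof -
  obtain i where i: "i \<le> n - w" "loss K w n f x A = real w - score f w x A i"
    using loss_attained assms by blast
  have iw: "i + w \<le> n" using i assms by auto
  have "score f w x A i = (\<Sum>k<f. \<Sum>a\<in>K. \<Sum>t<m. gain w x i a k * B t a k / real m)"
    by (simp add: score_eq_gain[OF assms(1,2) iw] A sum_distrib_left sum_divide_distrib)
  also have "\<dots> = (\<Sum>k<f. \<Sum>t<m. \<Sum>a\<in>K. gain w x i a k * B t a k / real m)"
    by (intro sum.cong refl sum.swap)
  also have "\<dots> = (\<Sum>t<m. \<Sum>k<f. \<Sum>a\<in>K. gain w x i a k * B t a k / real m)"
    by (rule sum.swap)
  also have "\<dots> = (\<Sum>t<m. score f w x (B t) i) / real m"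
    by (simp add: score_eq_gain[OF assms(1,2) iw] sum_divide_distrib)
  finally have "loss K w n f x A = (\<Sum>t<m. real w - score f w x (B t) i) / real m"
    using i assms(4) by (simp add: sum_subtractf diff_divide_distrib)
  also have "\<dots> \<le> (\<Sum>t<m. loss K w n f x (B t)) / real m"
    using loss_ge_score[OF assms(1-3) i(1)] by (intro divide_right_mono sum_mono) auto
  finally show ?thesis .
qed

section \<open>Attained minima over stochastic matrices\<close>

lemma uniform_in_stoch:
  assumes "finite K" "K \<noteq> {}"
  shows "(\<lambda>a k. 1 / real (card K)) \<in> stoch K C"
  using assms by (auto simp: stoch_def)

text \<open>\<open>stoch K {..<f}\<close> leaves entries off the index set free and is therefore not
  compact in the product topology. Its intersection with the box of all functions into
  \<open>[0, 1]\<close> is, by Tychonoff. An arbitrary competitor is moved into the box by zeroing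
  its entries off the index set, and the Lipschitz bound shows that this leaves \<open>h\<close>
  unchanged.\<close>

lemma lipschitz_attains_min_on_stoch:
  fixes h :: "('k \<Rightarrow> nat \<Rightarrow> real) \<Rightarrow> real"
  assumes "finite K" "K \<noteq> {}"
    and lip: "\<And>A B. A \<in> stoch K {..<f} \<Longrightarrow> B \<in> stoch K {..<f} \<Longrightarrow>
      \<bar>h A - h B\<bar> \<le> c * (\<Sum>k<f. \<Sum>a\<in>K. \<bar>A a k - B a k\<bar>)"
  obtains A where "is_arg_min h (\<lambda>A. A \<in> stoch K {..<f}) A"
proof -
  define box :: "('k \<Rightarrow> nat \<Rightarrow> real) set"
    where "box = PiE UNIV (\<lambda>_. PiE UNIV (\<lambda>_. {0..1}))"
  define X where "X = box \<inter> stoch K {..<f}"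
  have "compact (PiE UNIV (\<lambda>_. {0..1}) :: (nat \<Rightarrow> real) set)"
    using compactin_PiE[of "\<lambda>_. euclidean" "UNIV :: nat set" "\<lambda>_. {0..1::real}"]
    by (simp add: euclidean_product_topology)
  then have box: "compact box"
    using compactin_PiE[of "\<lambda>_. euclidean" "UNIV :: 'k set" "\<lambda>_. PiE UNIV (\<lambda>_. {0..1}) :: (nat \<Rightarrow> real) set"]
    by (simp add: euclidean_product_topology box_def)
  have coord: "continuous_on UNIV (\<lambda>A :: 'k \<Rightarrow> nat \<Rightarrow> real. A a k)" for a k
    by (rule continuous_on_product_then_coordinatewise) (rule continuous_on_product_coordinates)
  have "stoch K {..<f} = (\<Inter>a\<in>K. \<Inter>k\<in>{..<f}. {A. 0 \<le> A a k}) \<inter> (\<Inter>k\<in>{..<f}. {A. (\<Sum>a\<in>K. A a k) = 1})"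
    by (auto simp: stoch_def)
  also have "closed \<dots>"
    by (intro closed_Int closed_INT ballI closed_Collect_le closed_Collect_eq continuous_intros coord)
  finally have "compact X" unfolding X_def using box by (intro compact_Int_closed)
  moreover have "(\<lambda>a k. 1 / real (card K)) \<in> X"
  proof -
    have "1 / real (card K) \<le> 1" by (cases "card K") simp_all
    then show ?thesis
      using uniform_in_stoch[OF assms(1,2)] unfolding X_def box_def
      by (intro IntI PiE_I) auto
  qed
  moreover have "continuous_on X h"
    unfolding continuous_on_def
  proof
    fix A assume A: "A \<in> X"
    have "((\<lambda>B. c * (\<Sum>k<f. \<Sum>a\<in>K. \<bar>B a k - A a k\<bar>)) \<longlongrightarrow> c * (\<Sum>k<f. \<Sum>a\<in>K. \<bar>A a k - A a k\<bar>)) (at A within X)"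
    proof (intro tendsto_intros)
      fix a k
      show "((\<lambda>B. B a k) \<longlongrightarrow> A a k) (at A within X)"
        using continuous_on_subset[OF coord subset_UNIV] A unfolding continuous_on_def by blast
    qed
    then have lim: "((\<lambda>B. c * (\<Sum>k<f. \<Sum>a\<in>K. \<bar>B a k - A a k\<bar>)) \<longlongrightarrow> 0) (at A within X)" by simp
    have "\<forall>\<^sub>F B in at A within X. norm (h B - h A) \<le> c * (\<Sum>k<f. \<Sum>a\<in>K. \<bar>B a k - A a k\<bar>)"
      using A lip by (auto simp: eventually_at_filter X_def intro!: always_eventually)
    then have "((\<lambda>B. h B - h A) \<longlongrightarrow> 0) (at A within X)"
      by (rule Lim_null_comparison[OF _ lim])
    then show "(h \<longlongrightarrow> h A) (at A within X)" by (simp add: LIM_zero_iff)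
  qed
  ultimately obtain A where A: "A \<in> X" "\<And>B. B \<in> X \<Longrightarrow> h A \<le> h B"
    using continuous_attains_inf[of X h] by blast
  have "h A \<le> h B" if B: "B \<in> stoch K {..<f}" for B
  proof -
    define B' where "B' = (\<lambda>a k. if a \<in> K \<and> k < f then B a k else 0)"
    have B': "B' \<in> stoch K {..<f}" using B by (auto simp: stoch_def B'_def)
    have "B' \<in> X"
      using B' stochD(1)[OF B] stochD(3)[OF B] assms(1) by (auto simp: X_def box_def B'_def)
    moreover have "\<bar>h B' - h B\<bar> \<le> 0"
      using lip[OF B' B] by (simp add: B'_def)
    ultimately show ?thesis using A(2) by force
  qed
  then have "is_arg_min h (\<lambda>A. A \<in> stoch K {..<f}) A"
    using A(1) by (fastforce simp: is_arg_min_def X_def)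
  then show ?thesis using that by blast
qed

text \<open>The log weight of a fixed point \<open>a\<close> starts at \<open>- ln (card K)\<close>
  and ends at most at 0, while each step adds at least \<eta> times the advantage of
  \<open>a\<close> minus \<open>\<eta>\<^sup>2 * c\<^sup>2 / 2\<close>. Telescoping bounds the
  regret against every single point, and averaging with the weights \<open>B\<close> extends this to
  distributions. The update enters only through \<open>step\<close>, so that exponential and linear
  updates both fit.\<close>

lemma multiplicative_update_regret:
  fixes p v :: "nat \<Rightarrow> 'k \<Rightarrow> real"
  assumes K: "finite K" "K \<noteq> {}" and \<eta>: "\<eta> > 0"
    and init: "\<And>a. a \<in> K \<Longrightarrow> p 0 a = 1 / real (card K)"
    and step: "\<And>t a. t < T \<Longrightarrow> a \<in> K \<Longrightarrow>
      ln (p t a) + \<eta> * (v t a - (\<Sum>b\<in>K. p t b * v t b)) - \<eta>\<^sup>2 * c\<^sup>2 / 2 \<le> ln (p (Suc t) a)"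
    and final: "\<And>a. a \<in> K \<Longrightarrow> 0 < p T a \<and> p T a \<le> 1"
    and B: "\<And>a. a \<in> K \<Longrightarrow> 0 \<le> B a" "(\<Sum>a\<in>K. B a) = 1"
  shows "(\<Sum>t<T. \<Sum>a\<in>K. v t a * (B a - p t a)) \<le> ln (real (card K)) / \<eta> + \<eta> * real T * c\<^sup>2 / 2"
    (is "_ \<le> ?bound")
proof -
  define avg where "avg t = (\<Sum>b\<in>K. p t b * v t b)" for t
  have "(\<Sum>t<T. v t a - avg t) \<le> ?bound" if a: "a \<in> K" for a
  proof -
    have "\<eta> * (\<Sum>t<S. v t a - avg t) - real S * (\<eta>\<^sup>2 * c\<^sup>2 / 2) - ln (real (card K)) \<le> ln (p S a)"
      if "S \<le> T" for S
      using that
    proof (induction S)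
      case 0
      then show ?case using a K by (simp add: init ln_div card_gt_0_iff)
    next
      case (Suc S)
      have "\<eta> * (\<Sum>t<Suc S. v t a - avg t) = \<eta> * (\<Sum>t<S. v t a - avg t) + \<eta> * (v S a - avg S)"
        "real (Suc S) * (\<eta>\<^sup>2 * c\<^sup>2 / 2) = real S * (\<eta>\<^sup>2 * c\<^sup>2 / 2) + \<eta>\<^sup>2 * c\<^sup>2 / 2"
        by (simp_all add: algebra_simps)
      then show ?case using step[of S a] Suc a unfolding avg_def by linarith
    qed
    from this[of T] have "\<eta> * (\<Sum>t<T. v t a - avg t) \<le> ln (real (card K)) + real T * (\<eta>\<^sup>2 * c\<^sup>2 / 2)"
      using final[OF a] ln_le_zero_iff[of "p T a"] by (simp del: ln_le_zero_iff)
    then show ?thesis using \<eta> by (simp add: field_simps power2_eq_square)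
  qed
  then have "(\<Sum>a\<in>K. B a * (\<Sum>t<T. v t a - avg t)) \<le> (\<Sum>a\<in>K. B a * ?bound)"
    using B by (intro sum_mono mult_left_mono) auto
  also have "\<dots> = ?bound" using B(2) by (simp flip: sum_distrib_right)
  also have "(\<Sum>a\<in>K. B a * (\<Sum>t<T. v t a - avg t)) = (\<Sum>t<T. \<Sum>a\<in>K. B a * (v t a - avg t))"
    unfolding sum_distrib_left by (rule sum.swap)
  also have "\<dots> = (\<Sum>t<T. \<Sum>a\<in>K. v t a * (B a - p t a))"
  proof (rule sum.cong[OF refl])
    fix t
    have "(\<Sum>a\<in>K. B a * (v t a - avg t)) = (\<Sum>a\<in>K. B a * v t a) - (\<Sum>a\<in>K. B a) * avg t"
      by (simp add: right_diff_distrib sum_subtractf sum_distrib_right)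
    then show "(\<Sum>a\<in>K. B a * (v t a - avg t)) = (\<Sum>a\<in>K. v t a * (B a - p t a))"
      by (simp add: B(2) avg_def right_diff_distrib sum_subtractf mult.commute)
  qed
  finally show ?thesis .
qed

section \<open>Exponentiated gradient\<close>

text \<open>The product of \<open>1 - x + x\<^sup>2 / 2\<close> and
  \<open>1 + x + x\<^sup>2 / 2\<close> equals \<open>1 + x^4 / 4\<close>, and the second factor is
  at most \<open>exp x\<close>.\<close>

lemma exp_minus_le_quadratic:
  fixes x :: real
  assumes "x \<ge> 0"
  shows "exp (- x) \<le> 1 - x + x\<^sup>2 / 2"
proof -
  have pos: "0 < 1 - x + x\<^sup>2 / 2"
    using zero_le_power2[of "x - 1"] by (simp add: power2_eq_square algebra_simps)
  have "1 \<le> (1 - x + x\<^sup>2 / 2) * (1 + x + x\<^sup>2 / 2)"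
    using zero_le_power2[of "x\<^sup>2"] by (simp add: power2_eq_square algebra_simps)
  also have "\<dots> \<le> (1 - x + x\<^sup>2 / 2) * exp x"
    using pos exp_lower_Taylor_quadratic[OF assms] by (intro mult_left_mono) auto
  finally show ?thesis by (simp add: exp_minus field_simps)
qed

lemma eg_pos:
  assumes "finite K" "K \<noteq> {}"
  shows "0 < eg \<alpha> K g t a k"
  using assms
proof (induction t arbitrary: a)
  case 0
  then show ?case by (simp add: card_gt_0_iff)
next
  case (Suc t)
  then show ?case by (auto intro!: divide_pos_pos mult_pos_pos sum_pos)
qed

lemma eg_in_stoch:
  assumes "finite K" "K \<noteq> {}"
  shows "eg \<alpha> K g t \<in> stoch K C"
proof -
  have "(\<Sum>a\<in>K. eg \<alpha> K g t a k) = 1" for k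
  proof (cases t)
    case (Suc t')
    have "0 < (\<Sum>b\<in>K. eg \<alpha> K g t' b k * exp (- \<alpha> * g t' b k))"
      using assms eg_pos[OF assms] by (intro sum_pos) auto
    then show ?thesis using Suc by (simp flip: sum_divide_distrib)
  qed (use assms in simp)
  then show ?thesis using eg_pos[OF assms] by (auto simp: stoch_def less_imp_le)
qed

text \<open>The perturbed matrix \<open>B\<close> leaves the set of stochastic matrices, so the
  subgradient inequality on the whole matrix space matters: relative to stochastic matrices alone, a
  constant could be added to any column of \<open>g\<close>.\<close>

lemma subgradient_loss_bounds:
  assumes sub: "is_subgradient K f (loss K w n f x) A g"
    and x: "valid_sample K n f x" "finite K" "w \<le> n" and a: "a \<in> K" and k: "k < f"
  shows "- real w \<le> g a k" "g a k \<le> 0"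
proof -
  have *: "\<exists>i\<le>n - w. c * g a k \<le> - c * gain w x i a k" for c
  proof -
    define B where "B = (\<lambda>b l. if b = a \<and> l = k then A b l + c else A b l)"
    have single: "(\<Sum>l<f. \<Sum>b\<in>K. h b l * (B b l - A b l)) = c * h a k" for h :: "'a \<Rightarrow> nat \<Rightarrow> real"
    proof -
      have "(\<Sum>b\<in>K. h b l * (B b l - A b l)) = (if l = k then c * h a k else 0)" for l
        using x(2) a by (auto simp: B_def if_distrib[of "\<lambda>u. h _ _ * u"] if_distrib[of "\<lambda>u. u - _"]
            sum.delta mult.commute cong: if_cong conj_cong)
      then show ?thesis using k by simp
    qed
    obtain i where i: "i \<le> n - w" "loss K w n f x B = real w - score f w x B i"
      using loss_attained[OF x] by blast
    have iw: "i + w \<le> n" using i x by auto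
    have "c * g a k = (\<Sum>b\<in>K. \<Sum>l<f. g b l * (B b l - A b l))"
      by (subst sum.swap) (simp add: single)
    also have "\<dots> \<le> loss K w n f x B - loss K w n f x A"
      using sub unfolding is_subgradient_def by (simp add: algebra_simps)
    also have "\<dots> \<le> score f w x A i - score f w x B i"
      using loss_ge_score[OF x i(1), of A] i by simp
    also have "\<dots> = - (\<Sum>l<f. \<Sum>b\<in>K. gain w x i b l * (B b l - A b l))"
      by (simp add: score_eq_gain[OF x(1,2) iw] sum_subtractf algebra_simps)
    also have "\<dots> = - c * gain w x i a k" by (simp add: single)
    finally show ?thesis using i(1) by blast
  qed
  \<comment> \<open>An increase of the entry bounds \<open>g a k\<close> from above by minus a gain;
    a decrease bounds it from below by minus a gain, of a possibly different window.\<close>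
  obtain i where i: "i \<le> n - w" "g a k \<le> - gain w x i a k" using *[of 1] by auto
  obtain i' where i': "i' \<le> n - w" "- g a k \<le> gain w x i' a k" using *[of "-1"] by auto
  have "i + w \<le> n" "i' + w \<le> n" using i i' x(3) by auto
  then show "- real w \<le> g a k" "g a k \<le> 0"
    using i i' gain_bounds[OF x(1) _ k] by (meson neg_le_iff_le order_trans minus_le_iff neg_le_0_iff_le)+
qed

text \<open>Shifting the slopes by \<open>c\<close> makes the exponents nonpositive, where
  \<open>exp (- x)\<close> has a quadratic upper bound with coefficient 1/2; the shift cancels
  against the factor \<open>exp (\<alpha> * c)\<close>. Since \<open>g t b k + c\<close> lies in
  \<open>[0, c]\<close>, the quadratic term is at most
  \<open>\<alpha>\<^sup>2 * c\<^sup>2 / 2\<close>, and \<open>1 + y \<le> exp y\<close> yields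
  \<open>ln Z \<le> - \<alpha> * avg + \<alpha>\<^sup>2 * c\<^sup>2 / 2\<close>.\<close>

lemma eg_step:
  assumes K: "finite K" "K \<noteq> {}" and \<alpha>: "\<alpha> > 0"
    and g: "\<And>b. b \<in> K \<Longrightarrow> - c \<le> g t b k \<and> g t b k \<le> 0"
  shows "ln (eg \<alpha> K g t a k) + \<alpha> * (- g t a k - (\<Sum>b\<in>K. eg \<alpha> K g t b k * - g t b k)) - \<alpha>\<^sup>2 * c\<^sup>2 / 2
     \<le> ln (eg \<alpha> K g (Suc t) a k)"
proof -
  define p where "p b = eg \<alpha> K g t b k" for b
  define Z where "Z = (\<Sum>b\<in>K. p b * exp (- \<alpha> * g t b k))"
  define avg where "avg = (\<Sum>b\<in>K. p b * g t b k)"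
  have p: "0 < p b" for b unfolding p_def using K by (rule eg_pos)
  have sum_p: "(\<Sum>b\<in>K. p b) = 1"
    using eg_in_stoch[OF K, of \<alpha> g t "{k}"] by (simp add: stoch_def p_def)
  have Z: "0 < Z" unfolding Z_def using p K by (intro sum_pos) auto
  have "Z \<le> (\<Sum>b\<in>K. p b * (exp (\<alpha> * c) * (1 - \<alpha> * (g t b k + c) + \<alpha>\<^sup>2 * c\<^sup>2 / 2)))"
    unfolding Z_def
  proof (intro sum_mono mult_left_mono)
    fix b assume b: "b \<in> K"
    have "exp (- \<alpha> * g t b k) = exp (\<alpha> * c) * exp (- (\<alpha> * (g t b k + c)))"
      by (simp add: algebra_simps flip: exp_add)
    also have "\<dots> \<le> exp (\<alpha> * c) * (1 - \<alpha> * (g t b k + c) + (\<alpha> * (g t b k + c))\<^sup>2 / 2)"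
      using \<alpha> g[OF b] by (intro mult_left_mono exp_minus_le_quadratic) auto
    also have "\<dots> \<le> exp (\<alpha> * c) * (1 - \<alpha> * (g t b k + c) + \<alpha>\<^sup>2 * c\<^sup>2 / 2)"
    proof -
      have "(\<alpha> * (g t b k + c))\<^sup>2 \<le> \<alpha>\<^sup>2 * c\<^sup>2"
        unfolding power_mult_distrib using \<alpha> g[OF b] by (intro mult_left_mono power_mono) auto
      then show ?thesis by simp
    qed
    finally show "exp (- \<alpha> * g t b k) \<le> exp (\<alpha> * c) * (1 - \<alpha> * (g t b k + c) + \<alpha>\<^sup>2 * c\<^sup>2 / 2)" .
  qed (use p in \<open>auto simp: less_imp_le\<close>)
  also have "\<dots> = (\<Sum>b\<in>K. exp (\<alpha> * c) * ((1 - \<alpha> * c + \<alpha>\<^sup>2 * c\<^sup>2 / 2) * p b - \<alpha> * (p b * g t b k)))"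
    by (intro sum.cong refl) (simp add: algebra_simps)
  also have "\<dots> = exp (\<alpha> * c) * (1 + (- \<alpha> * avg - \<alpha> * c + \<alpha>\<^sup>2 * c\<^sup>2 / 2))"
    by (simp add: sum_subtractf sum_p avg_def flip: sum_distrib_left)
  also have "\<dots> \<le> exp (\<alpha> * c) * exp (- \<alpha> * avg - \<alpha> * c + \<alpha>\<^sup>2 * c\<^sup>2 / 2)"
    by (intro mult_left_mono exp_ge_add_one_self) auto
  also have "\<dots> = exp (- \<alpha> * avg + \<alpha>\<^sup>2 * c\<^sup>2 / 2)" by (simp flip: exp_add)
  finally have "ln Z \<le> - \<alpha> * avg + \<alpha>\<^sup>2 * c\<^sup>2 / 2"
    using Z by (metis ln_exp ln_le_cancel_iff exp_gt_zero)
  moreover have "ln (eg \<alpha> K g (Suc t) a k) = ln (p a) - \<alpha> * g t a k - ln Z"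
  proof -
    have "eg \<alpha> K g (Suc t) a k = p a * exp (- \<alpha> * g t a k) / Z" by (simp add: p_def Z_def)
    then show ?thesis using p[of a] Z by (simp add: ln_div ln_mult)
  qed
  ultimately show ?thesis
    by (simp add: p_def[symmetric] sum_negf avg_def[symmetric] algebra_simps)
qed

lemma eg_regret:
  assumes K: "finite K" "K \<noteq> {}" and \<alpha>: "\<alpha> > 0" and w: "w \<le> n"
    and valid: "\<And>t. t < T \<Longrightarrow> valid_sample K n f (s t, F t)"
    and sub: "\<And>t. t < T \<Longrightarrow> is_subgradient K f (loss K w n f (s t, F t)) (eg \<alpha> K g t) (g t)"
    and B: "B \<in> stoch K {..<f}"
  shows "regret K w n f T s F (eg \<alpha> K g) B
    \<le> real f * (ln (real (card K)) / \<alpha> + \<alpha> * real T * (real w)\<^sup>2 / 2)"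
proof -
  have "regret K w n f T s F (eg \<alpha> K g) B \<le>
      (\<Sum>t<T. \<Sum>a\<in>K. \<Sum>k<f. - g t a k * (B a k - eg \<alpha> K g t a k))"
    unfolding regret_def
  proof (intro sum_mono)
    fix t assume "t \<in> {..<T}"
    then have "loss K w n f (s t, F t) (eg \<alpha> K g t) + (\<Sum>a\<in>K. \<Sum>k<f. g t a k * (B a k - eg \<alpha> K g t a k))
      \<le> loss K w n f (s t, F t) B"
      using sub[of t] unfolding is_subgradient_def by blast
    then show "U K w n (s t) (predict f (F t) (eg \<alpha> K g t)) - U K w n (s t) (predict f (F t) B)
      \<le> (\<Sum>a\<in>K. \<Sum>k<f. - g t a k * (B a k - eg \<alpha> K g t a k))"
      by (simp add: sum_negf)
  qed
  also have "\<dots> = (\<Sum>t<T. \<Sum>k<f. \<Sum>a\<in>K. - g t a k * (B a k - eg \<alpha> K g t a k))"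
    by (intro sum.cong refl sum.swap)
  also have "\<dots> = (\<Sum>k<f. \<Sum>t<T. \<Sum>a\<in>K. - g t a k * (B a k - eg \<alpha> K g t a k))"
    by (rule sum.swap)
  also have "\<dots> \<le> (\<Sum>k<f. ln (real (card K)) / \<alpha> + \<alpha> * real T * (real w)\<^sup>2 / 2)"
  proof (intro sum_mono)
    fix k assume "k \<in> {..<f}"
    then have k: "k < f" by simp
    show "(\<Sum>t<T. \<Sum>a\<in>K. - g t a k * (B a k - eg \<alpha> K g t a k))
      \<le> ln (real (card K)) / \<alpha> + \<alpha> * real T * (real w)\<^sup>2 / 2"
    proof (rule multiplicative_update_regret[OF K \<alpha>])
      fix t a assume t: "t < T" and "a \<in> K"
      show "ln (eg \<alpha> K g t a k) + \<alpha> * (- g t a k - (\<Sum>b\<in>K. eg \<alpha> K g t b k * - g t b k)) - \<alpha>\<^sup>2 * (real w)\<^sup>2 / 2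
        \<le> ln (eg \<alpha> K g (Suc t) a k)"
        using subgradient_loss_bounds[OF sub[OF t] valid[OF t] K(1) w _ k]
        by (intro eg_step[OF K \<alpha>]) auto
    qed (use eg_pos[OF K] stochD(3)[OF eg_in_stoch[OF K, where C = "{..<f}"]] K(1) k
          stochD(1,2)[OF B] in auto)
  qed
  finally show ?thesis by simp
qed

lemma card_eq_1_stoch:
  assumes "card K = 1" "A \<in> stoch K C" "a \<in> K" "k \<in> C"
  shows "A a k = 1"
  using assms by (auto simp: card_1_singleton_iff stoch_def)

lemma eg_regret_bound:
  assumes "setting K d D \<gamma> w n"
  shows "\<exists>\<alpha>>0. \<forall>(s :: nat \<Rightarrow> nat \<Rightarrow> 'k) F g.
           (\<forall>t<T. s t \<in> {..<n} \<rightarrow> K \<and> transpose_fun (F t) \<in> stoch {..<f} {..<n}) \<and>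
           (\<forall>t<T. is_subgradient K f (\<lambda>A. U K w n (s t) (predict f (F t) A)) (eg \<alpha> K g t) (g t)) \<longrightarrow>
           (\<exists>A_opt. is_arg_max (regret K w n f T s F (eg \<alpha> K g)) (\<lambda>A. A \<in> stoch K {..<f}) A_opt \<and>
                    regret K w n f T s F (eg \<alpha> K g) A_opt
                      \<le> \<gamma> * D * real f * sqrt (2 * real T * ln (real (card K))))"
proof -
  have K: "finite K" "K \<noteq> {}" and w: "real w = \<gamma> * D" "w \<le> n" "w > 0"
    using assms by (auto simp: setting_def)
  define L where "L = ln (real (card K))"
  have card: "card K > 0" using K by (simp add: card_gt_0_iff)
  then have L: "L \<ge> 0" by (simp add: L_def)
  \<comment> \<open>The minimizer of \<open>L / \<alpha> + \<alpha> * T * w\<^sup>2 / 2\<close>,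
    whose minimum \<open>w * sqrt (2 * T * L)\<close> is the bound per column. For
    \<open>T = 0\<close> or \<open>L = 0\<close> the formula gives 0, which is not a legal step
    size, so 1 serves as default.\<close>
  define \<alpha> where "\<alpha> = (if T = 0 \<or> card K = 1 then 1 else sqrt (2 * L / real T) / real w)"
  have L_pos: "L > 0" if "card K \<noteq> 1" using that card by (simp add: L_def)
  have \<alpha>: "\<alpha> > 0" using L_pos w by (auto simp: \<alpha>_def)
  show ?thesis
  proof (intro exI[of _ \<alpha>] conjI \<alpha> allI impI, elim conjE)
    fix s :: "nat \<Rightarrow> nat \<Rightarrow> 'k" and F g
    assume valid': "\<forall>t<T. s t \<in> {..<n} \<rightarrow> K \<and> transpose_fun (F t) \<in> stoch {..<f} {..<n}"
      and sub': "\<forall>t<T. is_subgradient K f (\<lambda>A. U K w n (s t) (predict f (F t) A)) (eg \<alpha> K g t) (g t)"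
    let ?R = "regret K w n f T s F (eg \<alpha> K g)"
    have valid: "valid_sample K n f (s t, F t)" if "t < T" for t
      using valid' that by (simp add: valid_sample_def)
    have sub: "is_subgradient K f (loss K w n f (s t, F t)) (eg \<alpha> K g t) (g t)" if "t < T" for t
      using sub' that by simp
    obtain A_opt where opt: "is_arg_min (\<lambda>A. - ?R A) (\<lambda>A. A \<in> stoch K {..<f}) A_opt"
    proof (rule lipschitz_attains_min_on_stoch[OF K, of f "\<lambda>A. - ?R A" "real T * real w"])
      fix A B :: "'k \<Rightarrow> nat \<Rightarrow> real"
      have "\<bar>- ?R A - - ?R B\<bar> = \<bar>\<Sum>t<T. loss K w n f (s t, F t) A - loss K w n f (s t, F t) B\<bar>"
        by (simp add: regret_def sum_subtractf)
      also have "\<dots> \<le> (\<Sum>t<T. real w * (\<Sum>k<f. \<Sum>a\<in>K. \<bar>A a k - B a k\<bar>))"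
      proof (rule order_trans[OF sum_abs], rule sum_mono)
        fix t assume "t \<in> {..<T}"
        then show "\<bar>loss K w n f (s t, F t) A - loss K w n f (s t, F t) B\<bar>
          \<le> real w * (\<Sum>k<f. \<Sum>a\<in>K. \<bar>A a k - B a k\<bar>)"
          by (intro loss_lipschitz valid K w) simp
      qed
      finally show "\<bar>- ?R A - - ?R B\<bar> \<le> real T * real w * (\<Sum>k<f. \<Sum>a\<in>K. \<bar>A a k - B a k\<bar>)"
        by (simp add: mult.assoc)
    qed
    have A_opt: "A_opt \<in> stoch K {..<f}" using opt by (simp add: is_arg_min_def)
    have "?R A_opt \<le> \<gamma> * D * real f * sqrt (2 * real T * L)"
    proof (cases "T = 0 \<or> card K = 1")
      case True
      \<comment> \<open>With a single point all stochastic matrices agree on the index set and have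
        equal losses; without rounds the regret is an empty sum.\<close>
      have "loss K w n f (s t, F t) (eg \<alpha> K g t) - loss K w n f (s t, F t) A_opt = 0"
        if "t < T" for t
      proof -
        have "(\<Sum>k<f. \<Sum>a\<in>K. \<bar>eg \<alpha> K g t a k - A_opt a k\<bar>) = 0"
          using True that card_eq_1_stoch[OF _ A_opt] card_eq_1_stoch[OF _ eg_in_stoch[OF K, where C = "{..<f}"]]
          by (intro sum.neutral ballI) auto
        then show ?thesis
          using loss_lipschitz[OF valid[OF that] K(1) w(2), of "eg \<alpha> K g t" A_opt] by simp
      qed
      then have "?R A_opt = 0" unfolding regret_def by (intro sum.neutral) auto
      then show ?thesis using L w(1) by (simp flip: w(1))
    next
      case False
      then have \<alpha>_eq: "\<alpha> = sqrt (2 * L / real T) / real w" and T: "real T > 0" and Lp: "L > 0"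
        using L_pos by (auto simp: \<alpha>_def)
      have "L / \<alpha> + \<alpha> * real T * (real w)\<^sup>2 / 2 = real w * sqrt (2 * real T * L)"
      proof -
        define r where "r = sqrt (2 * real T * L)"
        have r: "r > 0" "r\<^sup>2 = 2 * real T * L" using T Lp by (auto simp: r_def)
        have "sqrt (2 * L / real T) = r / real T"
        proof (rule real_sqrt_unique)
          show "(r / real T)\<^sup>2 = 2 * L / real T"
            using T by (simp add: power_divide r) (simp add: power2_eq_square field_simps)
        qed (use r T in simp)
        then have \<alpha>_r: "\<alpha> = r / (real T * real w)" using \<alpha>_eq by simp
        have "L = r\<^sup>2 / (2 * real T)" using T r by simp
        then show ?thesis unfolding \<alpha>_r r_def[symmetric] using r(1) T w(3)
          by (simp add: power2_eq_square field_simps)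
      qed
      moreover have "?R A_opt \<le> real f * (L / \<alpha> + \<alpha> * real T * (real w)\<^sup>2 / 2)"
        unfolding L_def by (intro eg_regret K \<alpha> w valid sub A_opt)
      ultimately show ?thesis using w(1) by (simp add: mult_ac)
    qed
    then show "\<exists>A_opt. is_arg_max ?R (\<lambda>A. A \<in> stoch K {..<f}) A_opt \<and>
        ?R A_opt \<le> \<gamma> * D * real f * sqrt (2 * real T * ln (real (card K)))"
      using opt by (auto simp: is_arg_min_def is_arg_max_def L_def)
  qed
qed

section \<open>The linear multiplicative update\<close>

text \<open>The first minimizer below the given bound, with 0 as default. The explicit recursion
  mirrors the search loop of the program, ties included, and makes the choice measurable.\<close>

primrec argmin_upto :: "(nat \<Rightarrow> real) \<Rightarrow> nat \<Rightarrow> nat" where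
  "argmin_upto h 0 = 0"
| "argmin_upto h (Suc i) = (if h i < h (argmin_upto h i) then i else argmin_upto h i)"

lemma argmin_upto_less: "0 < c \<Longrightarrow> b \<le> c \<Longrightarrow> argmin_upto h b < c"
  by (induction b) auto

lemma argmin_upto_le: "i < b \<Longrightarrow> h (argmin_upto h b) \<le> h i"
  by (induction b) (auto simp: less_Suc_eq)

definition worst_window :: "nat \<Rightarrow> nat \<Rightarrow> nat \<Rightarrow> 'k sample \<Rightarrow> ('k \<Rightarrow> nat \<Rightarrow> real) \<Rightarrow> nat" where
  "worst_window f w n x A = argmin_upto (score f w x A) (n - w + 1)"

lemma worst_window_le: "worst_window f w n x A \<le> n - w"
  using argmin_upto_less[of "n - w + 1" "n - w + 1" "score f w x A"] by (simp add: worst_window_def)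

lemma loss_worst_window:
  assumes "valid_sample K n f x" "finite K" "w \<le> n"
  shows "loss K w n f x A = real w - score f w x A (worst_window f w n x A)"
proof (rule antisym)
  obtain i where i: "i \<le> n - w" "loss K w n f x A = real w - score f w x A i"
    using loss_attained[OF assms] by blast
  then show "loss K w n f x A \<le> real w - score f w x A (worst_window f w n x A)"
    using argmin_upto_le[of i "n - w + 1" "score f w x A"] by (simp add: worst_window_def)
qed (rule loss_ge_score[OF assms worst_window_le])

definition mw_weight ::
  "real \<Rightarrow> nat \<Rightarrow> nat \<Rightarrow> nat \<Rightarrow> 'k sample \<Rightarrow> ('k \<Rightarrow> nat \<Rightarrow> real) \<Rightarrow> 'k \<Rightarrow> nat \<Rightarrow> real" where
  "mw_weight \<eta> f w n x A a k = A a k * (1 + \<eta> * gain w x (worst_window f w n x A) a k)"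

primrec mw :: "real \<Rightarrow> 'k set \<Rightarrow> nat \<Rightarrow> nat \<Rightarrow> nat \<Rightarrow> (nat \<Rightarrow> 'k sample) \<Rightarrow> nat \<Rightarrow> 'k \<Rightarrow> nat \<Rightarrow> real" where
  "mw \<eta> K f w n z 0 = (\<lambda>a k. 1 / real (card K))"
| "mw \<eta> K f w n z (Suc t) = (\<lambda>a k. mw_weight \<eta> f w n (z t) (mw \<eta> K f w n z t) a k /
     (\<Sum>b\<in>K. mw_weight \<eta> f w n (z t) (mw \<eta> K f w n z t) b k))"

text \<open>Predictability: iterate \<open>t\<close> is a function of the samples before
  \<open>t\<close>. The martingale argument rests on it.\<close>

lemma mw_cong: "(\<And>\<tau>. \<tau> < t \<Longrightarrow> z \<tau> = z' \<tau>) \<Longrightarrow> mw \<eta> K f w n z t = mw \<eta> K f w n z' t"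
  by (induction t) (auto simp del: fun_eq_iff)

lemma mw_pos:
  assumes "finite K" "K \<noteq> {}" "w \<le> n" "\<eta> > 0" "k < f"
    and "\<And>\<tau>. \<tau> < t \<Longrightarrow> valid_sample K n f (z \<tau>)"
  shows "0 < mw \<eta> K f w n z t a k"
  using assms
proof (induction t arbitrary: a)
  case 0
  then show ?case by (simp add: card_gt_0_iff)
next
  case (Suc t)
  have "0 \<le> gain w (z t) (worst_window f w n (z t) A) b k" for b A
    using Suc.prems worst_window_le[of f w n "z t" A] by (intro gain_bounds(1)[of K n f]) auto
  then have "0 < 1 + \<eta> * gain w (z t) (worst_window f w n (z t) A) b k" for b A
    using Suc.prems(4) by (intro add_pos_nonneg mult_nonneg_nonneg) auto
  then show ?case
    using Suc by (auto intro!: divide_pos_pos mult_pos_pos sum_pos simp: mw_weight_def)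
qed

lemma mw_in_stoch:
  assumes "finite K" "K \<noteq> {}" "w \<le> n" "\<eta> > 0"
    and "\<And>\<tau>. \<tau> < t \<Longrightarrow> valid_sample K n f (z \<tau>)"
  shows "mw \<eta> K f w n z t \<in> stoch K {..<f}"
proof -
  have "(\<Sum>a\<in>K. mw \<eta> K f w n z t a k) = 1" if k: "k < f" for k
  proof (cases t)
    case (Suc t')
    have "0 < mw \<eta> K f w n z t a k" for a by (rule mw_pos[OF assms(1-4) k assms(5)])
    then have "(\<Sum>b\<in>K. mw_weight \<eta> f w n (z t') (mw \<eta> K f w n z t') b k) \<noteq> 0"
      using assms(2) by (auto simp: Suc)
    then show ?thesis using Suc by (simp flip: sum_divide_distrib)
  qed (use assms in simp)
  then show ?thesis using mw_pos[OF assms(1-4) _ assms(5)] by (auto simp: stoch_def less_imp_le)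
qed

text \<open>The difference of the two sides vanishes at 0 and has derivative
  \<open>y\<^sup>2 / (1 + y)\<close>.\<close>

lemma ln_one_plus_ge_quadratic:
  fixes x :: real
  assumes "x \<ge> 0"
  shows "x - x\<^sup>2 / 2 \<le> ln (1 + x)"
proof -
  define h where "h y = ln (1 + y) - (y - y\<^sup>2 / 2)" for y :: real
  have "h 0 \<le> h x"
  proof (rule DERIV_nonneg_imp_nondecreasing[OF assms])
    fix y :: real assume y: "0 \<le> y" "y \<le> x"
    have "(h has_real_derivative (1 / (1 + y) - (1 - y))) (at y)"
      unfolding h_def using y by (auto intro!: derivative_eq_intros)
    moreover have "1 / (1 + y) - (1 - y) = y\<^sup>2 / (1 + y)"
      using y by (simp add: field_simps power2_eq_square)
    ultimately show "\<exists>d. (h has_real_derivative d) (at y) \<and> 0 \<le> d"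
      using y by (intro exI[of _ "y\<^sup>2 / (1 + y)"]) auto
  qed
  then show ?thesis by (simp add: h_def)
qed

text \<open>The normalizer is \<open>1 + \<eta> * avg\<close> because the columns of the iterate sum
  to one. The logarithm of the factor \<open>1 + \<eta> * v t a k\<close> is bounded below by
  \<open>ln_one_plus_ge_quadratic\<close>, that of the normalizer above by
  \<open>ln (1 + y) \<le> y\<close>.\<close>

lemma mw_regret:
  assumes K: "finite K" "K \<noteq> {}" and w: "w \<le> n" and \<eta>: "\<eta> > 0"
    and valid: "\<And>t. t < T \<Longrightarrow> valid_sample K n f (z t)"
    and B: "B \<in> stoch K {..<f}"
  shows "(\<Sum>t<T. loss K w n f (z t) (mw \<eta> K f w n z t) - loss K w n f (z t) B)
    \<le> real f * (ln (real (card K)) / \<eta> + \<eta> * real T * (real w)\<^sup>2 / 2)"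
proof -
  define p where "p t = mw \<eta> K f w n z t" for t
  define v where "v t = gain w (z t) (worst_window f w n (z t) (p t))" for t
  have ww: "worst_window f w n (z t) (p t) + w \<le> n" for t
    using worst_window_le[of f w n "z t" "p t"] w by linarith
  have v: "0 \<le> v t a k" "v t a k \<le> real w" if "t < T" "k < f" for t a k
    unfolding v_def using gain_bounds[OF valid[OF that(1)] ww that(2)] by auto
  have p_pos: "0 < p t a k" if "t \<le> T" "k < f" for t a k
    unfolding p_def using that by (intro mw_pos K w \<eta> valid) auto
  have p_stoch: "p t \<in> stoch K {..<f}" if "t \<le> T" for t
    unfolding p_def using that by (intro mw_in_stoch K w \<eta> valid) auto
  have "(\<Sum>t<T. loss K w n f (z t) (p t) - loss K w n f (z t) B)
      \<le> (\<Sum>t<T. \<Sum>k<f. \<Sum>a\<in>K. v t a k * (B a k - p t a k))"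
  proof (intro sum_mono)
    fix t assume "t \<in> {..<T}"
    then have val: "valid_sample K n f (z t)" using valid by simp
    \<comment> \<open>The window is worst for \<open>p t\<close>: it gives the loss of
      \<open>p t\<close> exactly and a lower bound for the loss of \<open>B\<close>.\<close>
    have "loss K w n f (z t) (p t) - loss K w n f (z t) B
        \<le> score f w (z t) B (worst_window f w n (z t) (p t)) - score f w (z t) (p t) (worst_window f w n (z t) (p t))"
      using loss_worst_window[OF val K(1) w, of "p t"] loss_ge_score[OF val K(1) w worst_window_le, of B f "z t" "p t"]
      by simp
    then show "loss K w n f (z t) (p t) - loss K w n f (z t) B \<le> (\<Sum>k<f. \<Sum>a\<in>K. v t a k * (B a k - p t a k))"
      unfolding score_eq_gain[OF val K(1) ww]
      by (simp add: v_def sum_subtractf algebra_simps)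
  qed
  also have "\<dots> = (\<Sum>k<f. \<Sum>t<T. \<Sum>a\<in>K. v t a k * (B a k - p t a k))" by (rule sum.swap)
  also have "\<dots> \<le> (\<Sum>k<f. ln (real (card K)) / \<eta> + \<eta> * real T * (real w)\<^sup>2 / 2)"
  proof (intro sum_mono)
    fix k assume "k \<in> {..<f}"
    then have k: "k < f" by simp
    show "(\<Sum>t<T. \<Sum>a\<in>K. v t a k * (B a k - p t a k))
      \<le> ln (real (card K)) / \<eta> + \<eta> * real T * (real w)\<^sup>2 / 2"
    proof (rule multiplicative_update_regret[OF K \<eta>])
      fix t a assume t: "t < T" and a: "a \<in> K"
      define avg where "avg = (\<Sum>b\<in>K. p t b k * v t b k)"
      have avg: "0 \<le> avg" unfolding avg_def
        using p_pos[of t k] v(1)[OF t k] t k by (intro sum_nonneg mult_nonneg_nonneg) (auto simp: less_imp_le)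
      have "(\<Sum>b\<in>K. mw_weight \<eta> f w n (z t) (p t) b k) = (\<Sum>b\<in>K. p t b k) + \<eta> * avg"
        by (simp add: mw_weight_def v_def avg_def sum.distrib sum_distrib_left algebra_simps)
      also have "(\<Sum>b\<in>K. p t b k) = 1" using p_stoch[of t] t k by (simp add: stoch_def)
      finally have p_Suc: "p (Suc t) a k = p t a k * (1 + \<eta> * v t a k) / (1 + \<eta> * avg)"
        by (simp add: p_def mw_weight_def v_def)
      have "0 \<le> \<eta> * v t a k" using v(1)[OF t k] \<eta> by simp
      moreover have "0 \<le> \<eta> * avg" using avg \<eta> by simp
      ultimately have "ln (p (Suc t) a k) = ln (p t a k) + ln (1 + \<eta> * v t a k) - ln (1 + \<eta> * avg)"
        unfolding p_Suc using p_pos[of t k a] t k by (simp add: ln_mult ln_div)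
      moreover have "\<eta> * v t a k - (\<eta> * v t a k)\<^sup>2 / 2 \<le> ln (1 + \<eta> * v t a k)"
        using \<open>0 \<le> \<eta> * v t a k\<close> by (rule ln_one_plus_ge_quadratic)
      moreover have "(\<eta> * v t a k)\<^sup>2 \<le> \<eta>\<^sup>2 * (real w)\<^sup>2"
        unfolding power_mult_distrib using v[OF t k] by (intro mult_left_mono power_mono) auto
      moreover have "ln (1 + \<eta> * avg) \<le> \<eta> * avg"
        using \<open>0 \<le> \<eta> * avg\<close> by (rule ln_add_one_self_le_self)
      ultimately show "ln (p t a k) + \<eta> * (v t a k - (\<Sum>b\<in>K. p t b k * v t b k)) - \<eta>\<^sup>2 * (real w)\<^sup>2 / 2
        \<le> ln (p (Suc t) a k)"
        by (simp add: avg_def[symmetric] algebra_simps)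
    qed (use p_pos[of T k] stochD(3)[OF p_stoch[of T]] K(1) k stochD(1,2)[OF B] in
        \<open>auto simp: p_def\<close>)
  qed
  finally show ?thesis by (simp add: p_def)
qed

section \<open>Measurability of losses and iterates\<close>

lemma space_sample_space:
  assumes "x \<in> space (sample_space K n f)"
  shows "valid_sample K n f x"
proof -
  have "x \<in> {(s, F). transpose_fun F \<in> stoch {..<f} {..<n}}"
    and "fst x \<in> space (\<Pi>\<^sub>M j\<in>{..<n}. count_space K)"
    using assms by (simp_all only: sample_space_def space_restrict_space space_pair_measure Int_iff mem_Times_iff)
  then show ?thesis unfolding valid_sample_def space_PiM by (auto simp only: split_beta mem_Collect_eq space_count_space PiE_iff Pi_iff)
qed

lemma measurable_request:
  assumes "j < n"
  shows "(\<lambda>x. fst x j) \<in> measurable (sample_space K n f) (count_space K)"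
  unfolding sample_space_def using assms
  by (intro measurable_restrict_space1 measurable_compose[OF measurable_fst measurable_component_singleton]) auto

lemma measurable_feature:
  assumes "j < n" "k < f"
  shows "(\<lambda>x. snd x j k) \<in> borel_measurable (sample_space K n f)"
proof -
  have row: "(\<lambda>F. F j) \<in> measurable (\<Pi>\<^sub>M j\<in>{..<n}. \<Pi>\<^sub>M k\<in>{..<f}. (borel :: real measure))
      (\<Pi>\<^sub>M k\<in>{..<f}. borel)"
    using assms by (intro measurable_component_singleton) auto
  have entry: "(\<lambda>r. r k) \<in> measurable (\<Pi>\<^sub>M k\<in>{..<f}. (borel :: real measure)) borel"
    using assms by (intro measurable_component_singleton) auto
  show ?thesis unfolding sample_space_def
    by (intro measurable_restrict_space1 measurable_compose[OF measurable_snd measurable_compose[OF row entry]])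
qed

text \<open>Evaluating \<open>h\<close> at a random index is measurable since the index takes
  finitely many values.\<close>

lemma measurable_argmin_upto:
  assumes "\<And>i. i < c \<Longrightarrow> (\<lambda>\<omega>. h \<omega> i) \<in> borel_measurable M" "0 < c" "b \<le> c"
  shows "(\<lambda>\<omega>. argmin_upto (h \<omega>) b) \<in> measurable M (count_space {..<c})"
  using assms(3)
proof (induction b)
  case 0
  then show ?case using assms(2) by simp
next
  case (Suc b)
  then have arg: "(\<lambda>\<omega>. argmin_upto (h \<omega>) b) \<in> measurable M (count_space {..<c})" by simp
  have "(\<lambda>\<omega>. h \<omega> (argmin_upto (h \<omega>) b)) \<in> borel_measurable M"
    by (rule measurable_compose_countable'[where I = "{..<c}", OF _ arg]) (auto intro: assms(1))
  moreover have "(\<lambda>\<omega>. h \<omega> b) \<in> borel_measurable M" using Suc assms(1) by simp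
  ultimately have "Measurable.pred M (\<lambda>\<omega>. h \<omega> b < h \<omega> (argmin_upto (h \<omega>) b))" by measurable
  then show ?case using arg Suc.prems by (simp add: measurable_If)
qed

context
  fixes K :: "'k set" and w n f :: nat and M :: "'b measure"
    and y :: "'b \<Rightarrow> 'k sample" and A :: "'b \<Rightarrow> 'k \<Rightarrow> nat \<Rightarrow> real"
  assumes K: "finite K" and w: "w \<le> n"
    and y: "y \<in> measurable M (sample_space K n f)"
    and A: "\<And>a k. a \<in> K \<Longrightarrow> k < f \<Longrightarrow> (\<lambda>\<omega>. A \<omega> a k) \<in> borel_measurable M"
begin

text \<open>Sample and matrix both vary with \<omega>, so that the same statement serves fixed
  matrices, random iterates and pairs of a past and a fresh sample. The random row
  \<open>fst (y \<omega>) j\<close> of \<open>A \<omega>\<close> is harmless because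
  \<open>K\<close> is finite.\<close>

lemma measurable_score:
  assumes "i + w \<le> n"
  shows "(\<lambda>\<omega>. score f w (y \<omega>) (A \<omega>) i) \<in> borel_measurable M"
  unfolding score_def
proof (intro borel_measurable_sum borel_measurable_times)
  fix j k assume "j \<in> {i..<i + w}" "k \<in> {..<f}"
  then have jk: "j < n" "k < f" using assms by auto
  show "(\<lambda>\<omega>. snd (y \<omega>) j k) \<in> borel_measurable M"
    by (rule measurable_compose[OF y measurable_feature[OF jk]])
  show "(\<lambda>\<omega>. A \<omega> (fst (y \<omega>) j) k) \<in> borel_measurable M"
    by (rule measurable_compose_countable'[where I = K, OF _ measurable_compose[OF y measurable_request[OF jk(1)]]])
      (auto intro: A jk K countable_finite)
qed

lemma measurable_loss: "(\<lambda>\<omega>. loss K w n f (y \<omega>) (A \<omega>)) \<in> borel_measurable M"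
proof -
  have "(\<lambda>\<omega>. loss K w n f (y \<omega>) (A \<omega>)) \<in> borel_measurable M \<longleftrightarrow>
    (\<lambda>\<omega>. Max ((\<lambda>i. real w - score f w (y \<omega>) (A \<omega>) i) ` {0..n - w})) \<in> borel_measurable M"
    by (intro measurable_cong loss_eq_Max_score K w space_sample_space measurable_space[OF y])
  also have \<dots>
    using w by (intro borel_measurable_Max borel_measurable_diff borel_measurable_const measurable_score) auto
  finally show ?thesis .
qed

lemma measurable_gain:
  assumes "i + w \<le> n" "k < f"
  shows "(\<lambda>\<omega>. gain w (y \<omega>) i a k) \<in> borel_measurable M"
  unfolding gain_def
proof (intro borel_measurable_sum)
  fix j assume "j \<in> {i..<i + w}"
  then have j: "j < n" using assms by auto
  have F: "(\<lambda>\<omega>. snd (y \<omega>) j k) \<in> borel_measurable M"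
    by (rule measurable_compose[OF y measurable_feature[OF j assms(2)]])
  show "(\<lambda>\<omega>. if fst (y \<omega>) j = a then snd (y \<omega>) j k else 0) \<in> borel_measurable M"
    by (rule measurable_compose_countable'[where I = K and f = "\<lambda>b \<omega>. if b = a then snd (y \<omega>) j k else 0",
          OF _ measurable_compose[OF y measurable_request[OF j]]])
      (use F K countable_finite in auto)
qed

lemma measurable_mw_weight:
  assumes "a \<in> K" "k < f"
  shows "(\<lambda>\<omega>. mw_weight \<eta> f w n (y \<omega>) (A \<omega>) a k) \<in> borel_measurable M"
proof -
  have "(\<lambda>\<omega>. worst_window f w n (y \<omega>) (A \<omega>)) \<in> measurable M (count_space {..<n - w + 1})"
    unfolding worst_window_def using w
    by (intro measurable_argmin_upto measurable_score) auto
  then have "(\<lambda>\<omega>. gain w (y \<omega>) (worst_window f w n (y \<omega>) (A \<omega>)) a k) \<in> borel_measurable M"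
    by (rule measurable_compose_countable'[where I = "{..<n - w + 1}", rotated])
      (use w assms in \<open>auto intro: measurable_gain\<close>)
  then show ?thesis unfolding mw_weight_def using A[OF assms] by measurable
qed

end

lemma measurable_mw:
  assumes K: "finite K" and w: "w \<le> n" and "a \<in> K" "k < f"
    and z: "\<And>\<tau>. \<tau> < t \<Longrightarrow> (\<lambda>\<omega>. z \<omega> \<tau>) \<in> measurable M (sample_space K n f)"
  shows "(\<lambda>\<omega>. mw \<eta> K f w n (z \<omega>) t a k) \<in> borel_measurable M"
  using assms(3-)
proof (induction t arbitrary: a k)
  case (Suc t)
  then have "(\<lambda>\<omega>. mw_weight \<eta> f w n (z \<omega> t) (mw \<eta> K f w n (z \<omega>) t) a k) \<in> borel_measurable M"
    if "a \<in> K" for a using that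
    by (intro measurable_mw_weight[OF K w]) auto
  then show ?case using Suc.prems
    by (simp add: borel_measurable_divide borel_measurable_sum)
qed simp

section \<open>Generalization of the averaged iterate\<close>

text \<open>In \<open>Y t z x\<close> the argument \<open>z\<close> is the past and \<open>x\<close>
  the fresh sample; \<open>restrict\<close> turns a longer sample vector into a point of the space
  of the past. The last coordinate is integrated out with the past held fixed, which replaces
  conditional expectations by Fubini's theorem. Nonnegative integrals avoid integrability side
  conditions.\<close>

lemma exp_sum_martingale_le:
  fixes D :: "'a measure" and Y :: "nat \<Rightarrow> (nat \<Rightarrow> 'a) \<Rightarrow> 'a \<Rightarrow> real"
  assumes D: "prob_space D" and l: "l > 0"
    and meas: "\<And>t. t < T \<Longrightarrow> (\<lambda>(z, x). Y t z x) \<in> borel_measurable (PiM {..<t} (\<lambda>_. D) \<Otimes>\<^sub>M D)"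
    and mean: "\<And>t z. t < T \<Longrightarrow> z \<in> space (PiM {..<t} (\<lambda>_. D)) \<Longrightarrow> (\<integral>x. Y t z x \<partial>D) = 0"
    and bound: "\<And>t z x. t < T \<Longrightarrow> z \<in> space (PiM {..<t} (\<lambda>_. D)) \<Longrightarrow> x \<in> space D \<Longrightarrow> \<bar>Y t z x\<bar> \<le> c"
  shows "(\<integral>\<^sup>+z. ennreal (exp (l * (\<Sum>t<T. Y t (restrict z {..<t}) (z t)))) \<partial>PiM {..<T} (\<lambda>_. D))
    \<le> ennreal (exp (real T * (l\<^sup>2 * c\<^sup>2 / 2)))"
  using meas mean bound
proof (induction T)
  case 0
  interpret product_prob_space "\<lambda>_. D" "{} :: nat set" by (rule product_prob_spaceI) (rule D)
  show ?case using prob_space.emeasure_space_1[OF P.prob_space_axioms] by simp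
next
  case (Suc T)
  interpret D: prob_space D by (rule D)
  interpret product_prob_space "\<lambda>_. D" "{..<Suc T}" by (rule product_prob_spaceI) (rule D)
  let ?M = "\<lambda>T. PiM {..<T} (\<lambda>_. D)"
  let ?S = "\<lambda>T z. \<Sum>t<T. Y t (restrict z {..<t}) (z t)"
  have Y_meas: "(\<lambda>z. Y t (restrict z {..<t}) (z t)) \<in> borel_measurable (?M S)"
    if "t < S" "S \<le> Suc T" for t S
  proof -
    have "(\<lambda>z. (restrict z {..<t}, z t)) \<in> measurable (?M S) (?M t \<Otimes>\<^sub>M D)"
      using that by (intro measurable_Pair measurable_restrict_subset measurable_component_singleton) auto
    from measurable_compose[OF this Suc.prems(1)[of t]] that show ?thesis by simp
  qed
  have S_meas: "(\<lambda>z. ennreal (exp (l * ?S S z))) \<in> borel_measurable (?M S)" if "S \<le> Suc T" for S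
    using Y_meas that by (intro measurable_compose[OF _ measurable_ennreal] borel_measurable_exp
        borel_measurable_times borel_measurable_const borel_measurable_sum measurable_compose[OF _ borel_measurable_exp]) auto
  have "(\<integral>\<^sup>+z. ennreal (exp (l * ?S (Suc T) z)) \<partial>?M (Suc T))
      = (\<integral>\<^sup>+z. \<integral>\<^sup>+x. ennreal (exp (l * ?S (Suc T) (z(T := x)))) \<partial>D \<partial>?M T)"
    using S_meas[of "Suc T"] unfolding lessThan_Suc
    by (subst product_nn_integral_insert) (auto simp: lessThan_Suc)
  also have "\<dots> = (\<integral>\<^sup>+z. ennreal (exp (l * ?S T z)) * (\<integral>\<^sup>+x. ennreal (exp (l * Y T z x)) \<partial>D) \<partial>?M T)"
  proof (intro nn_integral_cong)
    fix z assume z: "z \<in> space (?M T)"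
    have "restrict z {..<T} = z"
      using z by (auto simp: space_PiM PiE_def extensional_def restrict_def fun_eq_iff)
    have "?S T (z(T := x)) = ?S T z" for x
    proof (intro sum.cong refl)
      fix t assume "t \<in> {..<T}"
      then have "restrict (z(T := x)) {..<t} = restrict z {..<t}" "(z(T := x)) t = z t"
        by (auto simp: restrict_def fun_eq_iff)
      then show "Y t (restrict (z(T := x)) {..<t}) ((z(T := x)) t) = Y t (restrict z {..<t}) (z t)" by simp
    qed
    then have "ennreal (exp (l * ?S (Suc T) (z(T := x)))) = ennreal (exp (l * ?S T z)) * ennreal (exp (l * Y T z x))" for x
      by (simp add: \<open>restrict z {..<T} = z\<close> ring_distribs exp_add ennreal_mult del: restrict_apply)
    moreover have "(\<lambda>x. Y T z x) \<in> borel_measurable D"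
      using measurable_compose_Pair1[OF z Suc.prems(1)[of T]] by simp
    then have "(\<lambda>x. ennreal (exp (l * Y T z x))) \<in> borel_measurable D" by measurable
    ultimately show "(\<integral>\<^sup>+x. ennreal (exp (l * ?S (Suc T) (z(T := x)))) \<partial>D)
        = ennreal (exp (l * ?S T z)) * (\<integral>\<^sup>+x. ennreal (exp (l * Y T z x)) \<partial>D)"
      by (simp only: nn_integral_cmult)
  qed
  also have "\<dots> \<le> (\<integral>\<^sup>+z. ennreal (exp (l * ?S T z)) * ennreal (exp (l\<^sup>2 * c\<^sup>2 / 2)) \<partial>?M T)"
  proof (intro nn_integral_mono mult_left_mono)
    fix z assume z: "z \<in> space (?M T)"
    have "(\<lambda>x. Y T z x) \<in> borel_measurable D"
      using measurable_compose_Pair1[OF z Suc.prems(1)[of T]] by simp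
    then interpret interval_bounded_random_variable D "Y T z" "- c" c
      using Suc.prems(3)[OF _ z] by unfold_locales (auto simp: abs_le_iff minus_le_iff)
    \<comment> \<open>Hoeffding's lemma for mean zero and an interval of length
      \<open>2 * c\<close>: the exponent is \<open>l\<^sup>2 * (2 * c)\<^sup>2 / 8\<close>.\<close>
    show "(\<integral>\<^sup>+x. ennreal (exp (l * Y T z x)) \<partial>D) \<le> ennreal (exp (l\<^sup>2 * c\<^sup>2 / 2))"
      using Hoeffdings_lemma_nn_integral_0[OF l] Suc.prems(2)[OF _ z] by (simp add: power2_eq_square mult_ac)
  qed simp
  also have "\<dots> = (\<integral>\<^sup>+z. ennreal (exp (l * ?S T z)) \<partial>?M T) * ennreal (exp (l\<^sup>2 * c\<^sup>2 / 2))"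
    using S_meas[of T] by (intro nn_integral_multc) auto
  also have "\<dots> \<le> ennreal (exp (real T * (l\<^sup>2 * c\<^sup>2 / 2))) * ennreal (exp (l\<^sup>2 * c\<^sup>2 / 2))"
    by (intro mult_right_mono Suc.IH Suc.prems less_SucI) simp_all
  also have "\<dots> = ennreal (exp (real (Suc T) * (l\<^sup>2 * c\<^sup>2 / 2)))"
    by (simp add: algebra_simps flip: ennreal_mult exp_add)
  finally show ?case .
qed

lemma azuma_hoeffding:
  fixes D :: "'a measure" and Y :: "nat \<Rightarrow> (nat \<Rightarrow> 'a) \<Rightarrow> 'a \<Rightarrow> real"
  assumes D: "prob_space D" and c: "c > 0" and u: "u > 0" and T: "T > 0"
    and meas: "\<And>t. t < T \<Longrightarrow> (\<lambda>(z, x). Y t z x) \<in> borel_measurable (PiM {..<t} (\<lambda>_. D) \<Otimes>\<^sub>M D)"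
    and mean: "\<And>t z. t < T \<Longrightarrow> z \<in> space (PiM {..<t} (\<lambda>_. D)) \<Longrightarrow> (\<integral>x. Y t z x \<partial>D) = 0"
    and bound: "\<And>t z x. t < T \<Longrightarrow> z \<in> space (PiM {..<t} (\<lambda>_. D)) \<Longrightarrow> x \<in> space D \<Longrightarrow> \<bar>Y t z x\<bar> \<le> c"
    and E: "E \<in> sets (PiM {..<T} (\<lambda>_. D))"
    and large: "\<And>z. z \<in> E \<Longrightarrow> u \<le> (\<Sum>t<T. Y t (restrict z {..<t}) (z t))"
  shows "measure (PiM {..<T} (\<lambda>_. D)) E \<le> exp (- u\<^sup>2 / (2 * real T * c\<^sup>2))"
proof -
  interpret product_prob_space "\<lambda>_. D" "{..<T}" by (rule product_prob_spaceI) (rule D)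
  let ?M = "PiM {..<T} (\<lambda>_. D)"
  let ?S = "\<lambda>z. \<Sum>t<T. Y t (restrict z {..<t}) (z t)"
  \<comment> \<open>The minimizer of the Chernoff exponent
    \<open>- l * u + T * (l\<^sup>2 * c\<^sup>2 / 2)\<close>.\<close>
  define l where "l = u / (real T * c\<^sup>2)"
  have l: "l > 0" using c u T by (simp add: l_def)
  have "(\<lambda>z. Y t (restrict z {..<t}) (z t)) \<in> borel_measurable ?M" if "t < T" for t
  proof -
    have "(\<lambda>z. (restrict z {..<t}, z t)) \<in> measurable ?M (PiM {..<t} (\<lambda>_. D) \<Otimes>\<^sub>M D)"
      using that by (intro measurable_Pair measurable_restrict_subset measurable_component_singleton) auto
    from measurable_compose[OF this meas[OF that]] show ?thesis by simp
  qed
  then have S: "?S \<in> borel_measurable ?M" by (intro borel_measurable_sum) auto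
  have "{z \<in> space ?M. u \<le> ?S z} = {z \<in> space ?M. 1 \<le> ennreal (exp (- l * u)) * ennreal (exp (l * ?S z))}"
    using l by (auto simp: field_simps simp flip: ennreal_mult exp_add ennreal_1 intro!: Collect_cong)
  then have "emeasure ?M {z \<in> space ?M. u \<le> ?S z}
      \<le> ennreal (exp (- l * u)) * (\<integral>\<^sup>+z. ennreal (exp (l * ?S z)) * indicator (space ?M) z \<partial>?M)"
    using S by (simp only:) (intro nn_integral_Markov_inequality, auto)
  also have "(\<integral>\<^sup>+z. ennreal (exp (l * ?S z)) * indicator (space ?M) z \<partial>?M) = (\<integral>\<^sup>+z. ennreal (exp (l * ?S z)) \<partial>?M)"
    by (intro nn_integral_cong) simp
  also have "ennreal (exp (- l * u)) * \<dots> \<le> ennreal (exp (- l * u)) * ennreal (exp (real T * (l\<^sup>2 * c\<^sup>2 / 2)))"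
    by (intro mult_left_mono exp_sum_martingale_le[OF D l meas mean bound]) auto
  also have "\<dots> = ennreal (exp (- l * u + real T * (l\<^sup>2 * c\<^sup>2 / 2)))"
    by (simp flip: ennreal_mult exp_add)
  also have "- l * u + real T * (l\<^sup>2 * c\<^sup>2 / 2) = - u\<^sup>2 / (2 * real T * c\<^sup>2)"
    using c T by (simp add: l_def field_simps power2_eq_square)
  finally have "emeasure ?M {z \<in> space ?M. u \<le> ?S z} \<le> ennreal (exp (- u\<^sup>2 / (2 * real T * c\<^sup>2)))" .
  moreover have "emeasure ?M E \<le> emeasure ?M {z \<in> space ?M. u \<le> ?S z}"
    using E large S sets.sets_into_space[OF E] by (intro emeasure_mono) auto
  ultimately have "ennreal (measure ?M E) \<le> ennreal (exp (- u\<^sup>2 / (2 * real T * c\<^sup>2)))"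
    unfolding P.emeasure_eq_measure[symmetric] by (rule order_trans[rotated])
  then show ?thesis by (simp only: ennreal_le_iff exp_ge_zero)
qed

text \<open>Averages the iterates \<open>0\<close> to \<open>m - 1\<close>, each as it stood before
  its own sample was processed.\<close>

definition mw_average :: "real \<Rightarrow> 'k set \<Rightarrow> nat \<Rightarrow> nat \<Rightarrow> nat \<Rightarrow> nat \<Rightarrow> (nat \<Rightarrow> 'k sample) \<Rightarrow> 'k \<Rightarrow> nat \<Rightarrow> real" where
  "mw_average \<eta> K f w n m z a k = (\<Sum>t<m. mw \<eta> K f w n z t a k) / real m"

context
  fixes K :: "'k set" and w n f :: nat and \<D> :: "'k sample measure"
  assumes K: "finite K" "K \<noteq> {}" and w: "w \<le> n" "w > 0"
    and D: "prob_space \<D>" and sets_D: "sets \<D> = sets (sample_space K n f)"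
begin

interpretation D: prob_space \<D> by (rule D)

lemma valid_sample_space: "x \<in> space \<D> \<Longrightarrow> valid_sample K n f x"
  using space_sample_space sets_eq_imp_space_eq[OF sets_D] by blast

lemma measurable_sample_space: "measurable M \<D> = measurable M (sample_space K n f)"
  by (intro measurable_cong_sets sets_D refl)

lemma risk_eq: "risk K w n f \<D> A = (\<integral>x. loss K w n f x A \<partial>\<D>)"
  unfolding risk_def by (intro Bochner_Integration.integral_cong) (auto simp: split_beta)

lemma integrable_loss:
  assumes "A \<in> stoch K {..<f}"
  shows "integrable \<D> (\<lambda>x. loss K w n f x A)"
proof (rule D.integrable_const_bound)
  show "AE x in \<D>. norm (loss K w n f x A) \<le> real w"
    using loss_bounds[OF valid_sample_space K(1) w(1) assms] by auto
  show "(\<lambda>x. loss K w n f x A) \<in> borel_measurable \<D>"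
    by (rule measurable_loss[OF K(1) w(1)]) (auto simp flip: measurable_sample_space)
qed

lemma risk_bounds:
  assumes "A \<in> stoch K {..<f}"
  shows "0 \<le> risk K w n f \<D> A" "risk K w n f \<D> A \<le> real w"
proof -
  note b = loss_bounds[OF valid_sample_space K(1) w(1) assms]
  show "0 \<le> risk K w n f \<D> A" unfolding risk_eq using b(1) by (intro integral_nonneg_AE) auto
  have "(\<integral>x. loss K w n f x A \<partial>\<D>) \<le> (\<integral>x. real w \<partial>\<D>)"
    using b(2) by (intro integral_mono integrable_loss assms) auto
  then show "risk K w n f \<D> A \<le> real w" unfolding risk_eq by (simp add: D.prob_space)
qed

lemma risk_lipschitz:
  assumes A: "A \<in> stoch K {..<f}" and B: "B \<in> stoch K {..<f}"
  shows "\<bar>risk K w n f \<D> A - risk K w n f \<D> B\<bar> \<le> real w * (\<Sum>k<f. \<Sum>a\<in>K. \<bar>A a k - B a k\<bar>)"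
proof -
  let ?L = "real w * (\<Sum>k<f. \<Sum>a\<in>K. \<bar>A a k - B a k\<bar>)"
  have *: "\<bar>loss K w n f x A - loss K w n f x B\<bar> \<le> ?L" if "x \<in> space \<D>" for x
    by (rule loss_lipschitz[OF valid_sample_space[OF that] K(1) w(1)])
  have int: "integrable \<D> (\<lambda>x. loss K w n f x A - loss K w n f x B)"
    by (intro Bochner_Integration.integrable_diff integrable_loss A B)
  have "\<bar>risk K w n f \<D> A - risk K w n f \<D> B\<bar> = \<bar>\<integral>x. loss K w n f x A - loss K w n f x B \<partial>\<D>\<bar>"
    unfolding risk_eq by (simp add: integrable_loss A B)
  also have "\<dots> \<le> (\<integral>x. \<bar>loss K w n f x A - loss K w n f x B\<bar> \<partial>\<D>)"
    by (rule integral_abs_bound)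
  also have "\<dots> \<le> (\<integral>x. ?L \<partial>\<D>)"
    using int * by (intro integral_mono) auto
  finally show ?thesis by (simp add: D.prob_space)
qed

lemma risk_attains_min: "\<exists>A. is_arg_min (risk K w n f \<D>) (\<lambda>A. A \<in> stoch K {..<f}) A"
  using lipschitz_attains_min_on_stoch[OF K risk_lipschitz] by metis

text \<open>Allows the output of the program, which is known only on \<open>K\<close> and
  \<open>{..<f}\<close>, to be exchanged for \<open>mw_average\<close>.\<close>

lemma risk_cong:
  assumes "\<And>a k. a \<in> K \<Longrightarrow> k < f \<Longrightarrow> A a k = B a k"
  shows "risk K w n f \<D> A = risk K w n f \<D> B"
proof -
  have "loss K w n f x A = loss K w n f x B" if "x \<in> space \<D>" for x
    using loss_lipschitz[OF valid_sample_space[OF that] K(1) w(1), of A B] assms by simp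
  then show ?thesis unfolding risk_eq by (intro Bochner_Integration.integral_cong) auto
qed

lemma risk_average_le:
  assumes m: "m > 0" and B: "\<And>t. t < m \<Longrightarrow> B t \<in> stoch K {..<f}"
    and A: "\<And>a k. a \<in> K \<Longrightarrow> k < f \<Longrightarrow> A a k = (\<Sum>t<m. B t a k) / real m"
    and A_stoch: "A \<in> stoch K {..<f}"
  shows "risk K w n f \<D> A \<le> (\<Sum>t<m. risk K w n f \<D> (B t)) / real m"
proof -
  have "(\<integral>x. loss K w n f x A \<partial>\<D>) \<le> (\<integral>x. (\<Sum>t<m. loss K w n f x (B t)) / real m \<partial>\<D>)"
    using loss_average_le[OF valid_sample_space K(1) w(1) m A] B A_stoch
    by (intro integral_mono integrable_divide Bochner_Integration.integrable_sum integrable_loss) auto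
  also have "\<dots> = (\<Sum>t<m. \<integral>x. loss K w n f x (B t) \<partial>\<D>) / real m"
    using B by (simp add: integrable_loss)
  finally show ?thesis by (simp add: risk_eq)
qed

lemma mw_average_in_stoch:
  assumes m: "m > 0" and "\<eta> > 0" and "\<And>t. t < m \<Longrightarrow> valid_sample K n f (z t)"
  shows "mw_average \<eta> K f w n m z \<in> stoch K {..<f}"
proof -
  have P: "mw \<eta> K f w n z t \<in> stoch K {..<f}" if "t < m" for t
    using that assms by (intro mw_in_stoch K w) auto
  have "(\<Sum>a\<in>K. mw_average \<eta> K f w n m z a k) = 1" if "k < f" for k
  proof -
    have "(\<Sum>a\<in>K. \<Sum>t<m. mw \<eta> K f w n z t a k) = (\<Sum>t<m. \<Sum>a\<in>K. mw \<eta> K f w n z t a k)" by (rule sum.swap)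
    also have "\<dots> = (\<Sum>t<m. 1)" using P that by (intro sum.cong refl) (auto simp: stoch_def)
    finally show ?thesis using m by (simp add: mw_average_def flip: sum_divide_distrib)
  qed
  moreover have "0 \<le> mw_average \<eta> K f w n m z a k" if "a \<in> K" "k < f" for a k
    unfolding mw_average_def using P that by (intro divide_nonneg_nonneg sum_nonneg) (auto simp: stoch_def)
  ultimately show ?thesis by (auto simp: stoch_def)
qed

text \<open>The loss is jointly measurable in \<omega> and the sample, so its integral over the
  sample is measurable in \<omega>.\<close>

lemma measurable_risk:
  assumes "\<And>a k. a \<in> K \<Longrightarrow> k < f \<Longrightarrow> (\<lambda>\<omega>. A \<omega> a k) \<in> borel_measurable M"
  shows "(\<lambda>\<omega>. risk K w n f \<D> (A \<omega>)) \<in> borel_measurable M"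
  unfolding risk_eq
proof (rule D.borel_measurable_lebesgue_integral)
  have "(\<lambda>p. loss K w n f (snd p) (A (fst p))) \<in> borel_measurable (M \<Otimes>\<^sub>M \<D>)"
    by (rule measurable_loss[OF K(1) w(1)])
      (auto simp flip: measurable_sample_space intro: measurable_compose[OF measurable_fst] assms)
  then show "(\<lambda>(\<omega>, x). loss K w n f x (A \<omega>)) \<in> borel_measurable (M \<Otimes>\<^sub>M \<D>)"
    by (simp add: split_beta')
qed

lemma mw_average_generalizes:
  assumes \<epsilon>: "\<epsilon> > 0" and \<delta>: "\<delta> > 0" and m: "m > 0" and f: "f > 0"
    and m_regret: "real m \<ge> 8 * (real w / \<epsilon>)\<^sup>2 * ((real f)\<^sup>2 * ln (real (card K)))"
    and m_conc: "real m \<ge> 32 * (real w / \<epsilon>)\<^sup>2 * ln (1 / \<delta>)"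
    and opt: "B \<in> stoch K {..<f}"
    and \<eta>: "\<eta> = \<epsilon> / (2 * real f * (real w)\<^sup>2)"
  shows "\<P>(z in (\<Pi>\<^sub>M i\<in>{..<m}. \<D>). risk K w n f \<D> (mw_average \<eta> K f w n m z) \<le> risk K w n f \<D> B + \<epsilon>) \<ge> 1 - \<delta>"
proof -
  interpret product_prob_space "\<lambda>_. \<D>" "{..<m}" by (rule product_prob_spaceI) (rule D)
  let ?M = "\<Pi>\<^sub>M i\<in>{..<m}. \<D>"
  let ?R = "risk K w n f \<D>" and ?A = "mw \<eta> K f w n"
  have \<eta>_pos: "\<eta> > 0" using \<epsilon> f w by (simp add: \<eta>)
  \<comment> \<open>The deviation of the iterate minus that of the comparator: one martingale for
    both. Each of the two lies in \<open>[- w, w]\<close>, whence the bound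
    \<open>2 * w\<close>.\<close>
  define Y where "Y t z x = (?R (?A z t) - loss K w n f x (?A z t)) - (?R B - loss K w n f x B)" for t z x
  have valid: "valid_sample K n f (z \<tau>)" if "z \<in> space (PiM {..<t} (\<lambda>_. \<D>))" "\<tau> < t" for z \<tau> and t :: nat
    using that by (intro valid_sample_space) (auto simp: space_PiM)
  have A_stoch: "?A z t \<in> stoch K {..<f}" if "z \<in> space (PiM {..<S} (\<lambda>_. \<D>))" "t \<le> S" for z t and S :: nat
    using valid that by (intro mw_in_stoch K w \<eta>_pos) auto
  have A_meas: "(\<lambda>z. ?A z t a k) \<in> borel_measurable (PiM {..<S} (\<lambda>_. \<D>))"
    if "a \<in> K" "k < f" "t \<le> S" for t a k and S :: nat
    using that by (intro measurable_mw K w) (auto simp flip: measurable_sample_space)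
  define E where "E = {z \<in> space ?M. \<not> ?R (mw_average \<eta> K f w n m z) \<le> ?R B + \<epsilon>}"
  have "(\<lambda>z. ?R (mw_average \<eta> K f w n m z)) \<in> borel_measurable ?M"
    unfolding mw_average_def
    by (intro measurable_risk borel_measurable_divide borel_measurable_sum A_meas borel_measurable_const) auto
  then have E: "E \<in> sets ?M" and good: "{z \<in> space ?M. ?R (mw_average \<eta> K f w n m z) \<le> ?R B + \<epsilon>} = space ?M - E"
    unfolding E_def by (measurable, auto)
  have "measure ?M E \<le> exp (- (real m * \<epsilon> / 2)\<^sup>2 / (2 * real m * (2 * real w)\<^sup>2))"
  proof (rule azuma_hoeffding[OF D, where Y = Y])
    fix t :: nat
    let ?N = "PiM {..<t} (\<lambda>_. \<D>)"
    have "(\<lambda>p. loss K w n f (snd p) (?A (fst p) t)) \<in> borel_measurable (?N \<Otimes>\<^sub>M \<D>)"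
      by (rule measurable_loss[OF K(1) w(1)])
        (auto simp flip: measurable_sample_space intro: measurable_compose[OF measurable_fst] A_meas)
    moreover have "(\<lambda>p. loss K w n f (snd p) B) \<in> borel_measurable (?N \<Otimes>\<^sub>M \<D>)"
      by (rule measurable_loss[OF K(1) w(1)]) (auto simp flip: measurable_sample_space)
    moreover have "(\<lambda>p. ?R (?A (fst p) t)) \<in> borel_measurable (?N \<Otimes>\<^sub>M \<D>)"
      by (intro measurable_compose[OF measurable_fst] measurable_risk A_meas) auto
    ultimately show "(\<lambda>(z, x). Y t z x) \<in> borel_measurable (?N \<Otimes>\<^sub>M \<D>)"
      unfolding Y_def split_beta' by (intro borel_measurable_diff borel_measurable_const)
    fix z assume z: "z \<in> space ?N"
    note stoch = A_stoch[OF z order_refl]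
    show "(\<integral>x. Y t z x \<partial>\<D>) = 0"
      unfolding Y_def using integrable_loss[OF stoch] integrable_loss[OF opt]
      by (simp add: risk_eq D.prob_space)
    fix x assume x: "x \<in> space \<D>"
    note lb = loss_bounds[OF valid_sample_space[OF x] K(1) w(1)]
    show "\<bar>Y t z x\<bar> \<le> 2 * real w"
      unfolding Y_def using lb[OF stoch] lb[OF opt] risk_bounds[OF stoch] risk_bounds[OF opt] by linarith
  next
    fix z assume "z \<in> E"
    then have z: "z \<in> space ?M" and bad: "?R B + \<epsilon> < ?R (mw_average \<eta> K f w n m z)" by (auto simp: E_def)
    have "?A (restrict z {..<t}) t = ?A z t" for t by (rule mw_cong) simp
    then have "Y t (restrict z {..<t}) (z t) = Y t z (z t)" for t
      unfolding Y_def by simp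
    then have "(\<Sum>t<m. Y t (restrict z {..<t}) (z t)) = (\<Sum>t<m. ?R (?A z t)) - real m * ?R B
       - (\<Sum>t<m. loss K w n f (z t) (?A z t) - loss K w n f (z t) B)"
      by (simp add: Y_def sum_subtractf)
    moreover have "?R (mw_average \<eta> K f w n m z) \<le> (\<Sum>t<m. ?R (?A z t)) / real m"
      using z by (intro risk_average_le m mw_average_in_stoch \<eta>_pos)
        (auto intro: A_stoch valid simp: mw_average_def)
    then have "?R B + \<epsilon> \<le> (\<Sum>t<m. ?R (?A z t)) / real m" using bad by linarith
    then have "real m * (?R B + \<epsilon>) \<le> (\<Sum>t<m. ?R (?A z t))"
      using m by (simp add: pos_le_divide_eq mult.commute)
    moreover have "(\<Sum>t<m. loss K w n f (z t) (?A z t) - loss K w n f (z t) B) \<le> real m * \<epsilon> / 2"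
    proof -
      have "(\<Sum>t<m. loss K w n f (z t) (?A z t) - loss K w n f (z t) B)
          \<le> real f * (ln (real (card K)) / \<eta> + \<eta> * real m * (real w)\<^sup>2 / 2)"
        using z by (intro mw_regret K w \<eta>_pos opt) (auto intro: valid)
      \<comment> \<open>The step size makes the second regret term exactly
        \<open>\<epsilon> * m / 4\<close>, and the lower bound \<open>m_regret\<close> on
        \<open>m\<close> does the same for the first, up to an inequality.\<close>
      also have "\<dots> = \<epsilon> / 4 * (8 * (real w / \<epsilon>)\<^sup>2 * ((real f)\<^sup>2 * ln (real (card K)))) + \<epsilon> * real m / 4"
        using \<epsilon> f w by (simp add: \<eta> field_simps power2_eq_square)
      also have "\<dots> \<le> \<epsilon> / 4 * real m + \<epsilon> * real m / 4"
        using m_regret \<epsilon> by (intro add_right_mono mult_left_mono) auto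
      finally show ?thesis by (simp add: mult.commute)
    qed
    ultimately show "real m * \<epsilon> / 2 \<le> (\<Sum>t<m. Y t (restrict z {..<t}) (z t))"
      by (simp add: distrib_left)
  qed (use m \<epsilon> w E in auto)
  also have "\<dots> \<le> exp (- ln (1 / \<delta>))"
  proof -
    have "ln (1 / \<delta>) = (8 * (real w / \<epsilon>)\<^sup>2 * 4 * ln (1 / \<delta>)) * (\<epsilon>\<^sup>2 / (32 * (real w)\<^sup>2))"
      using \<epsilon> w by (simp add: field_simps power2_eq_square)
    also have "\<dots> \<le> real m * (\<epsilon>\<^sup>2 / (32 * (real w)\<^sup>2))"
      using m_conc by (intro mult_right_mono) auto
    also have "\<dots> = (real m * \<epsilon> / 2)\<^sup>2 / (2 * real m * (2 * real w)\<^sup>2)"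
      using m w by (simp add: field_simps power2_eq_square)
    finally show ?thesis by simp
  qed
  also have "\<dots> = \<delta>" using \<delta> by (simp add: ln_div)
  finally show ?thesis unfolding good using P.prob_compl[OF E] by simp
qed

end

section \<open>Time-bounded executions\<close>

text \<open>The array of window scores agrees with \<open>score\<close> only at legal window starts;
  the search reads no other cell.\<close>

lemma argmin_upto_cong:
  assumes "\<And>i. i < c \<Longrightarrow> h i = h' i" "0 < c" "b \<le> c"
  shows "argmin_upto h b = argmin_upto h' b"
  using assms(3)
proof (induction b)
  case (Suc b)
  then show ?case using assms(1)[of b] assms(1)[OF argmin_upto_less[OF assms(2), of b h']] by simp
qed simp

text \<open>Tracks whole arrays by name. Arrays that a program writes have to be described cell by
  cell in its postcondition; all others are handled by \<open>frame\<close>.\<close>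

primrec nat_writes :: "com \<Rightarrow> string set" where
  "nat_writes Skip = {}"
| "nat_writes (NAssign x is a) = {x}"
| "nat_writes (RAssign x is a) = {}"
| "nat_writes (Seq c1 c2) = nat_writes c1 \<union> nat_writes c2"
| "nat_writes (If b c1 c2) = nat_writes c1 \<union> nat_writes c2"
| "nat_writes (While b c) = nat_writes c"

primrec real_writes :: "com \<Rightarrow> string set" where
  "real_writes Skip = {}"
| "real_writes (NAssign x is a) = {}"
| "real_writes (RAssign x is a) = {x}"
| "real_writes (Seq c1 c2) = real_writes c1 \<union> real_writes c2"
| "real_writes (If b c1 c2) = real_writes c1 \<union> real_writes c2"
| "real_writes (While b c) = real_writes c"

definition frame :: "com \<Rightarrow> state \<Rightarrow> state \<Rightarrow> bool" where
  "frame c \<sigma> \<sigma>' \<longleftrightarrow> (\<forall>x. x \<notin> nat_writes c \<longrightarrow> fst \<sigma>' x = fst \<sigma> x) \<and>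
     (\<forall>x. x \<notin> real_writes c \<longrightarrow> snd \<sigma>' x = snd \<sigma> x)"

lemma frameD:
  assumes "frame c \<sigma> \<sigma>'"
  shows "x \<notin> nat_writes c \<Longrightarrow> fst \<sigma>' x = fst \<sigma> x" "x \<notin> real_writes c \<Longrightarrow> snd \<sigma>' x = snd \<sigma> x"
  using assms by (auto simp: frame_def)

lemma exec_frame: "exec c \<sigma> t \<sigma>' \<Longrightarrow> frame c \<sigma> \<sigma>'"
  by (induction rule: exec.induct) (auto simp: frame_def upd_def)

text \<open>
  \<open>S\<close> bounds all loop counters, so that every loop nest of depth \<open>d\<close> costs at most a constant
  times \<open>S ^ d\<close>; the exponent of a loop body can be chosen freely to align exponents.
\<close>

definition run :: "nat \<Rightarrow> nat \<Rightarrow> nat \<Rightarrow> com \<Rightarrow> state \<Rightarrow> (state \<Rightarrow> bool) \<Rightarrow> bool" where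
  "run S e C c \<sigma> Q \<longleftrightarrow> (\<exists>t \<sigma>'. exec c \<sigma> t \<sigma>' \<and> t \<le> C * S ^ e \<and> Q \<sigma>')"

text \<open>The frame of the execution is available while weakening, so postconditions need to
  mention only what changes.\<close>

lemma run_weaken:
  assumes "run S e C c \<sigma> Q" "\<And>\<sigma>'. frame c \<sigma> \<sigma>' \<Longrightarrow> Q \<sigma>' \<Longrightarrow> Q' \<sigma>'"
  shows "run S e C c \<sigma> Q'"
  using assms exec_frame unfolding run_def by blast

lemma run_Seq:
  assumes "run S e C1 c1 \<sigma> Q" "\<And>\<sigma>'. frame c1 \<sigma> \<sigma>' \<Longrightarrow> Q \<sigma>' \<Longrightarrow> run S e C2 c2 \<sigma>' R"
  shows "run S e (C1 + C2) (Seq c1 c2) \<sigma> R"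
proof -
  obtain t1 \<sigma>' where 1: "exec c1 \<sigma> t1 \<sigma>'" "t1 \<le> C1 * S ^ e" "Q \<sigma>'"
    using assms(1) unfolding run_def by blast
  obtain t2 \<sigma>'' where 2: "exec c2 \<sigma>' t2 \<sigma>''" "t2 \<le> C2 * S ^ e" "R \<sigma>''"
    using assms(2)[OF exec_frame[OF 1(1)] 1(3)] unfolding run_def by blast
  show ?thesis unfolding run_def
    using exec_Seq[OF 1(1) 2(1)] 1(2) 2(2,3) by (intro exI[of _ "t1 + t2"] exI[of _ \<sigma>'']) (simp add: distrib_right)
qed

lemma run_Seq_eq:
  assumes "run S e C1 c1 \<sigma> (\<lambda>\<sigma>'. \<sigma>' = \<sigma>1)" "run S e C2 c2 \<sigma>1 R"
  shows "run S e (C1 + C2) (Seq c1 c2) \<sigma> R"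
  using assms by (auto intro: run_Seq)

lemma run_NAssign:
  assumes "1 \<le> S"
  shows "run S e 1 (NAssign x is a) \<sigma> (\<lambda>\<sigma>'. \<sigma>' = (upd (fst \<sigma>) x (map (nval \<sigma>) is) (nval \<sigma> a), snd \<sigma>))"
  unfolding run_def using exec_NAssign[of x "is" a \<sigma>] assms by fastforce

lemma run_RAssign:
  assumes "1 \<le> S"
  shows "run S e 1 (RAssign x is a) \<sigma> (\<lambda>\<sigma>'. \<sigma>' = (fst \<sigma>, upd (snd \<sigma>) x (map (nval \<sigma>) is) (rval \<sigma> a)))"
  unfolding run_def using exec_RAssign[of x "is" a \<sigma>] assms by fastforce

lemma run_Skip:
  assumes "1 \<le> S"
  shows "run S e 1 Skip \<sigma> (\<lambda>\<sigma>'. \<sigma>' = \<sigma>)"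
  unfolding run_def using exec_Skip[of \<sigma>] assms by fastforce

lemma run_If:
  assumes "1 \<le> S" "bval \<sigma> b \<Longrightarrow> run S e C c1 \<sigma> Q" "\<not> bval \<sigma> b \<Longrightarrow> run S e C c2 \<sigma> Q"
  shows "run S e (C + 1) (If b c1 c2) \<sigma> Q"
proof -
  have "\<exists>t \<sigma>'. exec (If b c1 c2) \<sigma> (t + 1) \<sigma>' \<and> t \<le> C * S ^ e \<and> Q \<sigma>'"
    using assms(2,3) exec_IfTrue exec_IfFalse unfolding run_def by (cases "bval \<sigma> b") blast+
  moreover have "1 \<le> S ^ e" using assms(1) by simp
  ultimately show ?thesis unfolding run_def by (metis add_mono distrib_right mult_1)
qed

definition For :: "string \<Rightarrow> nexp \<Rightarrow> com \<Rightarrow> com" where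
  "For x b c = Seq (NAssign x [] (NConst 0))
     (While (NLess (NCell x []) b) (Seq c (NAssign x [] (NPlus (NCell x []) (NConst 1)))))"

lemma writes_For [simp]:
  "nat_writes (For x b c) = insert x (nat_writes c)" "real_writes (For x b c) = real_writes c"
  by (auto simp: For_def)

lemma frame_trans: "frame c \<sigma> \<sigma>' \<Longrightarrow> frame c \<sigma>' \<sigma>'' \<Longrightarrow> frame c \<sigma> \<sigma>''"
  by (simp add: frame_def)

text \<open>The invariant is stated for the moments of the loop test, when the counter already has
  its new value. The frame refers to the state before the loop, which spares the invariant the
  arrays that the loop leaves alone. The expression \<open>b\<close> is evaluated anew at every
  test, hence the condition \<open>bound\<close>.\<close>

lemma run_For:
  assumes S: "1 \<le> S" and B: "B \<le> S" and x: "x \<notin> nat_writes c"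
    and bound: "\<And>i \<sigma>'. frame (For x b c) \<sigma> \<sigma>' \<Longrightarrow> I i \<sigma>' \<Longrightarrow> nval \<sigma>' b = B"
    and init: "I 0 (upd (fst \<sigma>) x [] 0, snd \<sigma>)"
    and step: "\<And>i \<sigma>'. i < B \<Longrightarrow> frame (For x b c) \<sigma> \<sigma>' \<Longrightarrow> fst \<sigma>' x [] = i \<Longrightarrow> I i \<sigma>' \<Longrightarrow>
      run S e C c \<sigma>' (\<lambda>\<sigma>''. I (Suc i) (upd (fst \<sigma>'') x [] (Suc i), snd \<sigma>''))"
  shows "run S (Suc e) (C + 4) (For x b c) \<sigma> (I B)"
proof -
  let ?body = "Seq c (NAssign x [] (NPlus (NCell x []) (NConst 1)))"
  let ?T = "C * S ^ e"
  have loop: "\<exists>t \<sigma>''. exec (While (NLess (NCell x []) b) ?body) \<sigma>' t \<sigma>'' \<and> t \<le> (B - i) * (?T + 2) + 1 \<and> I B \<sigma>''"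
    if "i \<le> B" "frame (For x b c) \<sigma> \<sigma>'" "fst \<sigma>' x [] = i" "I i \<sigma>'" for i \<sigma>'
    using that
  proof (induction "B - i" arbitrary: i \<sigma>')
    case 0
    then have "\<not> bval \<sigma>' (NLess (NCell x []) b)" using bound by simp
    from exec_WhileFalse[OF this, of ?body] 0 show ?case by fastforce
  next
    case (Suc d)
    then have i: "i < B" and d: "d = B - Suc i" by simp_all
    then have true: "bval \<sigma>' (NLess (NCell x []) b)" using bound Suc by simp
    obtain t1 \<sigma>1 where c: "exec c \<sigma>' t1 \<sigma>1" "t1 \<le> ?T" "I (Suc i) (upd (fst \<sigma>1) x [] (Suc i), snd \<sigma>1)"
      using step[OF i Suc.prems(2-4)] unfolding run_def by blast
    have "fst \<sigma>1 x [] = i" using frameD(1)[OF exec_frame[OF c(1)] x] Suc.prems(3) by simp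
    then have body: "exec ?body \<sigma>' (t1 + 1) (upd (fst \<sigma>1) x [] (Suc i), snd \<sigma>1)"
      using exec_Seq[OF c(1) exec_NAssign[of x "[]" "NPlus (NCell x []) (NConst 1)"]] by simp
    then have "frame (For x b c) \<sigma>' (upd (fst \<sigma>1) x [] (Suc i), snd \<sigma>1)"
      using exec_frame[OF body] by (auto simp: frame_def)
    then have "frame (For x b c) \<sigma> (upd (fst \<sigma>1) x [] (Suc i), snd \<sigma>1)"
      using Suc.prems(2) frame_trans by blast
    then obtain t2 \<sigma>2 where w: "exec (While (NLess (NCell x []) b) ?body) (upd (fst \<sigma>1) x [] (Suc i), snd \<sigma>1) t2 \<sigma>2"
      "t2 \<le> (B - Suc i) * (?T + 2) + 1" "I B \<sigma>2"
      using Suc.hyps(1)[OF d, of "(upd (fst \<sigma>1) x [] (Suc i), snd \<sigma>1)"] c(3) i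
      by (auto simp: upd_def)
    \<comment> \<open>The two extra steps are the increment and the successful test.\<close>
    have "t1 + 1 + t2 + 1 \<le> (?T + 2) + ((B - Suc i) * (?T + 2) + 1)" using c(2) w(2) by linarith
    also have "\<dots> = (B - i) * (?T + 2) + 1" by (simp only: Suc_diff_Suc[OF i, symmetric] mult_Suc add.assoc)
    finally show ?case using exec_WhileTrue[OF true body w(1)] w(3) by blast
  qed
  have start: "exec (NAssign x [] (NConst 0)) \<sigma> 1 (upd (fst \<sigma>) x [] 0, snd \<sigma>)"
    using exec_NAssign[of x "[]" "NConst 0" \<sigma>] by simp
  then have "frame (For x b c) \<sigma> (upd (fst \<sigma>) x [] 0, snd \<sigma>)"
    using exec_frame[OF start] by (auto simp: frame_def)
  from loop[OF _ this _ init] obtain t \<sigma>' where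
    w: "exec (While (NLess (NCell x []) b) ?body) (upd (fst \<sigma>) x [] 0, snd \<sigma>) t \<sigma>'"
    "t \<le> B * (?T + 2) + 1" "I B \<sigma>'"
    by (auto simp: upd_def)
  have one: "1 \<le> S ^ e" "1 \<le> S ^ Suc e" using S by (simp_all only: one_le_power)
  have "1 + t \<le> B * (?T + 2) + 2" using w(2) by simp
  \<comment> \<open>Increments and tests contribute \<open>2 * S ^ e\<close> per iteration; the
    initial assignment and the final test fit into \<open>2 * S ^ Suc e\<close>. This accounts for
    \<open>C + 4\<close>.\<close>
  also have "\<dots> \<le> S * (C * S ^ e + 2 * S ^ e) + 2 * S ^ Suc e"
    using B one by (intro add_mono mult_mono) auto
  also have "\<dots> = (C + 4) * S ^ Suc e" by (simp add: algebra_simps)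
  finally show ?thesis unfolding run_def For_def using exec_Seq[OF start w(1)] w(3) by blast
qed

lemma run_For_sum:
  assumes S: "1 \<le> S" and B: "B \<le> S" and x: "x \<notin> nat_writes c"
    and bound: "\<And>i r. nval (upd N x [] i, upd R y is r) b = B"
    and step: "\<And>i r. i < B \<Longrightarrow> run S e C c (upd N x [] i, upd R y is r)
      (\<lambda>\<sigma>'. \<sigma>' = (upd N x [] i, upd R y is (r + v i)))"
  shows "run S (Suc e) (C + 4) (For x b c) (N, upd R y is 0)
    (\<lambda>\<sigma>'. \<sigma>' = (upd N x [] B, upd R y is (\<Sum>i<B. v i)))"
proof -
  have "upd (upd N x [] i) x [] j = upd N x [] j" for i j by (simp add: upd_def)
  then show ?thesis
    using run_weaken[OF step]
    by (intro run_For[OF S B x, where I = "\<lambda>i \<sigma>'. \<sigma>' = (upd N x [] i, upd R y is (\<Sum>j<i. v j))"])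
      (auto simp: bound)
qed

section \<open>The learner as a program\<close>

abbreviation (input) Nat :: "string \<Rightarrow> nexp" where "Nat x \<equiv> NCell x []"
abbreviation (input) Zero :: rexp where "Zero \<equiv> RNat (NConst 0)"
abbreviation (input) One :: rexp where "One \<equiv> RNat (NConst 1)"
abbreviation (input) Windows :: nexp where "Windows \<equiv> NPlus (NMinus (Nat ''n'') (Nat ''w'')) (NConst 1)"

definition sum_loop :: "string \<Rightarrow> nexp list \<Rightarrow> string \<Rightarrow> nexp \<Rightarrow> rexp \<Rightarrow> com" where
  "sum_loop y is x b r = Seq (RAssign y is Zero) (For x b (RAssign y is (RPlus (RCell y is) r)))"

lemma writes_sum_loop [simp]:
  "nat_writes (sum_loop y is x b r) = {x}" "real_writes (sum_loop y is x b r) = {y}"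
  by (simp_all add: sum_loop_def)

text \<open>The \<open>stable\<close> conditions say that neither the counter nor the accumulator
  influences the target address and the loop bound. The final state is then known exactly.\<close>

lemma run_sum_loop:
  assumes S: "1 \<le> S" and B: "B \<le> S"
    and "map (nval \<sigma>) is = js"
    and stable: "\<And>i u. map (nval (upd (fst \<sigma>) x [] i, upd (snd \<sigma>) y js u)) is = js"
      "\<And>i u. nval (upd (fst \<sigma>) x [] i, upd (snd \<sigma>) y js u) b = B"
    and summand: "\<And>i u. i < B \<Longrightarrow> rval (upd (fst \<sigma>) x [] i, upd (snd \<sigma>) y js u) r = v i"
  shows "run S (Suc e) 6 (sum_loop y is x b r) \<sigma>
    (\<lambda>\<sigma>'. \<sigma>' = (upd (fst \<sigma>) x [] B, upd (snd \<sigma>) y js (\<Sum>i<B. v i)))"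
proof -
  have loop: "run S (Suc e) (1 + 4) (For x b (RAssign y is (RPlus (RCell y is) r))) (fst \<sigma>, upd (snd \<sigma>) y js 0)
      (\<lambda>\<sigma>'. \<sigma>' = (upd (fst \<sigma>) x [] B, upd (snd \<sigma>) y js (\<Sum>i<B. v i)))"
  proof (rule run_For_sum[OF S B])
    fix i u assume i: "i < B"
    show "run S e 1 (RAssign y is (RPlus (RCell y is) r)) (upd (fst \<sigma>) x [] i, upd (snd \<sigma>) y js u)
      (\<lambda>\<sigma>'. \<sigma>' = (upd (fst \<sigma>) x [] i, upd (snd \<sigma>) y js (u + v i)))"
      by (rule run_weaken[OF run_RAssign[OF S]]) (simp add: stable summand[OF i], simp add: upd_def)
  qed (use stable in auto)
  have "run S (Suc e) (1 + (1 + 4)) (sum_loop y is x b r) \<sigma>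
      (\<lambda>\<sigma>'. \<sigma>' = (upd (fst \<sigma>) x [] B, upd (snd \<sigma>) y js (\<Sum>i<B. v i)))"
    unfolding sum_loop_def by (rule run_Seq_eq[OF run_RAssign[OF S]]) (use loop assms(3) in simp)
  then show ?thesis by simp
qed

text \<open>The score of each single position is stored first, so that overlapping windows do not
  recompute inner products. The one-hot vector is resolved into a lookup of the row of
  \<open>P\<close> given by the request.\<close>

definition score_positions :: com where
  "score_positions = For ''j'' (Nat ''n'') (sum_loop ''q'' [Nat ''j''] ''k'' (Nat ''f'')
     (RTimes (RCell ''F'' [Nat ''t'', Nat ''j'', Nat ''k''])
       (RCell ''P'' [NCell ''s'' [Nat ''t'', Nat ''j''], Nat ''k''])))"

definition score_windows :: com where
  "score_windows = For ''i'' Windows (sum_loop ''Q'' [Nat ''i''] ''j'' (Nat ''w'')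
     (RCell ''q'' [NPlus (Nat ''i'') (Nat ''j'')]))"

definition find_worst :: com where
  "find_worst = Seq (NAssign ''b'' [] (NConst 0))
     (For ''i'' Windows (If (RLess (RCell ''Q'' [Nat ''i'']) (RCell ''Q'' [Nat ''b'']))
       (NAssign ''b'' [] (Nat ''i'')) Skip))"

text \<open>\<open>bexp\<close> has no equality test; two negated comparisons express that the
  request is the point \<open>a\<close>.\<close>

definition compute_gain :: com where
  "compute_gain = Seq (RAssign ''G'' [] Zero)
     (For ''j'' (Nat ''w'') (If
       (BAnd (BNot (NLess (NCell ''s'' [Nat ''t'', NPlus (Nat ''b'') (Nat ''j'')]) (Nat ''a'')))
         (BNot (NLess (Nat ''a'') (NCell ''s'' [Nat ''t'', NPlus (Nat ''b'') (Nat ''j'')]))))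
       (RAssign ''G'' [] (RPlus (RCell ''G'' []) (RCell ''F'' [Nat ''t'', NPlus (Nat ''b'') (Nat ''j''), Nat ''k''])))
       Skip))"

definition compute_weights :: com where
  "compute_weights = For ''k'' (Nat ''f'') (Seq
     (RAssign ''Z'' [Nat ''k''] Zero)
     (For ''a'' (Nat ''K'') (Seq compute_gain (Seq
       (RAssign ''W'' [Nat ''a'', Nat ''k''] (RTimes (RCell ''P'' [Nat ''a'', Nat ''k''])
         (RPlus One (RTimes (RCell ''eta'' []) (RCell ''G'' [])))))
       (RAssign ''Z'' [Nat ''k''] (RPlus (RCell ''Z'' [Nat ''k'']) (RCell ''W'' [Nat ''a'', Nat ''k''])))))))"

text \<open>\<open>A\<close> starts at 0 by the input convention and receives \<open>P / m\<close>
  before \<open>P\<close> is overwritten, so it collects the iterates before their updates, as in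
  \<open>mw_average\<close>.\<close>

definition update_iterate :: com where
  "update_iterate = For ''a'' (Nat ''K'') (For ''k'' (Nat ''f'') (Seq
     (RAssign ''A'' [Nat ''a'', Nat ''k''] (RPlus (RCell ''A'' [Nat ''a'', Nat ''k''])
       (RDivide (RCell ''P'' [Nat ''a'', Nat ''k'']) (RNat (Nat ''m'')))))
     (RAssign ''P'' [Nat ''a'', Nat ''k'']
       (RDivide (RCell ''W'' [Nat ''a'', Nat ''k'']) (RCell ''Z'' [Nat ''k''])))))"

definition initialize :: com where
  "initialize = Seq
     (RAssign ''eta'' [] (RDivide (RCell ''eps'' [])
       (RTimes (RTimes (RNat (NConst 2)) (RNat (Nat ''f''))) (RTimes (RNat (Nat ''w'')) (RNat (Nat ''w''))))))
     (For ''a'' (Nat ''K'') (For ''k'' (Nat ''f'')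
       (RAssign ''P'' [Nat ''a'', Nat ''k''] (RDivide One (RNat (Nat ''K''))))))"

definition mw_round :: com where
  "mw_round = Seq score_positions (Seq score_windows (Seq find_worst (Seq compute_weights update_iterate)))"

definition mw_program :: com where
  "mw_program = Seq initialize (For ''t'' (Nat ''m'') mw_round)"

section \<open>Correctness and running time of the stages\<close>

lemma run_score_positions:
  assumes S: "1 \<le> S" "fst \<sigma> ''n'' [] \<le> S" "fst \<sigma> ''f'' [] \<le> S"
  shows "run S (Suc (Suc e)) 10 score_positions \<sigma> (\<lambda>\<sigma>'. \<forall>j<fst \<sigma> ''n'' []. snd \<sigma>' ''q'' [j] =
    (\<Sum>k<fst \<sigma> ''f'' []. snd \<sigma> ''F'' [fst \<sigma> ''t'' [], j, k] * snd \<sigma> ''P'' [fst \<sigma> ''s'' [fst \<sigma> ''t'' [], j], k]))"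
    (is "run S _ 10 _ _ (\<lambda>\<sigma>'. \<forall>j<?n. _ = (\<Sum>k<?f. ?v j k))")
proof -
  have "run S (Suc (Suc e)) (6 + 4) score_positions \<sigma> (\<lambda>\<sigma>'. \<forall>j<?n. snd \<sigma>' ''q'' [j] = (\<Sum>k<?f. ?v j k))"
    unfolding score_positions_def
  proof (rule run_For[OF S(1,2)], goal_cases)
    case (4 j \<sigma>')
    then have fr: "x \<notin> {''j'', ''k''} \<Longrightarrow> fst \<sigma>' x = fst \<sigma> x" "x \<noteq> ''q'' \<Longrightarrow> snd \<sigma>' x = snd \<sigma> x" for x
      by (auto dest: frameD)
    show ?case
      by (rule run_weaken[OF run_sum_loop[where v = "?v j" and js = "[j]" and B = ?f]])
        (use 4 S in \<open>auto simp: fr upd_def less_Suc_eq\<close>)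
  qed (auto simp: frame_def)
  then show ?thesis by simp
qed

lemma run_score_windows:
  assumes S: "1 \<le> S" "fst \<sigma> ''n'' [] - fst \<sigma> ''w'' [] + 1 \<le> S" "fst \<sigma> ''w'' [] \<le> S"
  shows "run S (Suc (Suc e)) 10 score_windows \<sigma> (\<lambda>\<sigma>'. \<forall>i<fst \<sigma> ''n'' [] - fst \<sigma> ''w'' [] + 1.
    snd \<sigma>' ''Q'' [i] = (\<Sum>j<fst \<sigma> ''w'' []. snd \<sigma> ''q'' [i + j]))"
    (is "run S _ 10 _ _ (\<lambda>\<sigma>'. \<forall>i<?n. _ = (\<Sum>j<?w. ?v i j))")
proof -
  have "run S (Suc (Suc e)) (6 + 4) score_windows \<sigma> (\<lambda>\<sigma>'. \<forall>i<?n. snd \<sigma>' ''Q'' [i] = (\<Sum>j<?w. ?v i j))"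
    unfolding score_windows_def
  proof (rule run_For[OF S(1,2)], goal_cases)
    case (4 i \<sigma>')
    then have fr: "x \<notin> {''i'', ''j''} \<Longrightarrow> fst \<sigma>' x = fst \<sigma> x" "x \<noteq> ''Q'' \<Longrightarrow> snd \<sigma>' x = snd \<sigma> x" for x
      by (auto dest: frameD)
    show ?case
      by (rule run_weaken[OF run_sum_loop[where v = "?v i" and js = "[i]" and B = ?w]])
        (use 4 S in \<open>auto simp: fr upd_def less_Suc_eq\<close>)
  qed (auto simp: frame_def)
  then show ?thesis by simp
qed

lemma run_find_worst:
  assumes S: "1 \<le> S" "fst \<sigma> ''n'' [] - fst \<sigma> ''w'' [] + 1 \<le> S"
  shows "run S (Suc e) 7 find_worst \<sigma> (\<lambda>\<sigma>'. fst \<sigma>' ''b'' [] =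
    argmin_upto (\<lambda>i. snd \<sigma> ''Q'' [i]) (fst \<sigma> ''n'' [] - fst \<sigma> ''w'' [] + 1))"
    (is "run S _ 7 _ _ (\<lambda>\<sigma>'. _ = ?arg ?n)")
proof -
  have "run S (Suc e) (1 + ((1 + 1) + 4)) find_worst \<sigma> (\<lambda>\<sigma>'. fst \<sigma>' ''b'' [] = ?arg ?n)"
    unfolding find_worst_def
  proof (rule run_Seq_eq[OF run_NAssign[OF S(1)]], rule run_For[OF S(1,2)], goal_cases)
    case (4 i \<sigma>')
    then have fr: "x \<notin> {''i'', ''b''} \<Longrightarrow> fst \<sigma>' x = fst \<sigma> x" "snd \<sigma>' x = snd \<sigma> x" for x
      by (auto simp: frame_def upd_def)
    show ?case
      by (rule run_If[OF S(1)];
          rule run_weaken[OF run_NAssign[OF S(1)]] run_weaken[OF run_Skip[OF S(1)]])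
        (use 4 in \<open>auto simp: fr upd_def\<close>)
  qed (auto simp: frame_def upd_def)
  then show ?thesis by simp
qed

lemma run_compute_gain:
  assumes S: "1 \<le> S" "fst \<sigma> ''w'' [] \<le> S"
  shows "run S (Suc e) 7 compute_gain \<sigma> (\<lambda>\<sigma>'. snd \<sigma>' ''G'' [] = (\<Sum>j<fst \<sigma> ''w'' [].
      if fst \<sigma> ''s'' [fst \<sigma> ''t'' [], fst \<sigma> ''b'' [] + j] = fst \<sigma> ''a'' []
      then snd \<sigma> ''F'' [fst \<sigma> ''t'' [], fst \<sigma> ''b'' [] + j, fst \<sigma> ''k'' []] else 0))"
    (is "run S _ 7 _ _ (\<lambda>\<sigma>'. _ = (\<Sum>j<?w. ?v j))")
proof -
  have "run S (Suc e) (1 + ((1 + 1) + 4)) compute_gain \<sigma> (\<lambda>\<sigma>'. snd \<sigma>' ''G'' [] = (\<Sum>j<?w. ?v j))"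
    unfolding compute_gain_def
  proof (rule run_Seq_eq[OF run_RAssign[OF S(1)]], rule run_For[OF S(1,2)], goal_cases)
    case (4 i \<sigma>')
    then have fr: "x \<noteq> ''j'' \<Longrightarrow> fst \<sigma>' x = fst \<sigma> x" "x \<noteq> ''G'' \<Longrightarrow> snd \<sigma>' x = snd \<sigma> x" for x
      by (auto simp: frame_def upd_def)
    show ?case
      by (rule run_If[OF S(1)];
          rule run_weaken[OF run_RAssign[OF S(1)]] run_weaken[OF run_Skip[OF S(1)]])
        (use 4 in \<open>auto simp: fr upd_def\<close>)
  qed (auto simp: frame_def upd_def)
  then show ?thesis by simp
qed

lemma writes_compute_gain [simp]:
  "nat_writes compute_gain = {''j''}" "real_writes compute_gain = {''G''}"
  by (simp_all add: compute_gain_def)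

lemma run_compute_weights:
  fixes \<sigma> :: state
  defines "g \<equiv> \<lambda>a k. \<Sum>j<fst \<sigma> ''w'' [].
      if fst \<sigma> ''s'' [fst \<sigma> ''t'' [], fst \<sigma> ''b'' [] + j] = a
      then snd \<sigma> ''F'' [fst \<sigma> ''t'' [], fst \<sigma> ''b'' [] + j, k] else 0"
  defines "v \<equiv> \<lambda>a k. snd \<sigma> ''P'' [a, k] * (1 + snd \<sigma> ''eta'' [] * g a k)"
  assumes S: "1 \<le> S" "fst \<sigma> ''K'' [] \<le> S" "fst \<sigma> ''f'' [] \<le> S" "fst \<sigma> ''w'' [] \<le> S"
  shows "run S (Suc (Suc (Suc e))) 18 compute_weights \<sigma> (\<lambda>\<sigma>'. \<forall>k<fst \<sigma> ''f'' [].
    (\<forall>a<fst \<sigma> ''K'' []. snd \<sigma>' ''W'' [a, k] = v a k) \<and> snd \<sigma>' ''Z'' [k] = (\<Sum>a<fst \<sigma> ''K'' []. v a k))"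
    (is "run S _ 18 _ _ (\<lambda>\<sigma>'. \<forall>k<?f. (\<forall>a<?K. ?W \<sigma>' a k) \<and> _)")
proof -
  have "run S (Suc (Suc (Suc e))) ((1 + ((7 + (1 + 1)) + 4)) + 4) compute_weights \<sigma>
      (\<lambda>\<sigma>'. \<forall>k<?f. (\<forall>a<?K. ?W \<sigma>' a k) \<and> snd \<sigma>' ''Z'' [k] = (\<Sum>a<?K. v a k))"
    unfolding compute_weights_def
  proof (rule run_For[OF S(1,3)], goal_cases)
    case (4 k \<sigma>')
    then have fr: "x \<notin> {''a'', ''j'', ''k''} \<Longrightarrow> fst \<sigma>' x = fst \<sigma> x"
      "x \<notin> {''G'', ''W'', ''Z''} \<Longrightarrow> snd \<sigma>' x = snd \<sigma> x" for x
      by (auto simp: frame_def)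
    show ?case
    \<comment> \<open>The inner invariant keeps the finished columns below \<open>k\<close> and
      describes column \<open>k\<close> up to row \<open>i\<close>, with the partial sum of its
      normalizer.\<close>
    proof (rule run_Seq_eq[OF run_RAssign[OF S(1)]],
        rule run_weaken[OF run_For[OF S(1,2), where I = "\<lambda>i \<sigma>''. (\<forall>k'<k. (\<forall>a<?K. ?W \<sigma>'' a k') \<and>
          snd \<sigma>'' ''Z'' [k'] = (\<Sum>a<?K. v a k')) \<and> (\<forall>a<i. ?W \<sigma>'' a k) \<and> snd \<sigma>'' ''Z'' [k] = (\<Sum>a<i. v a k)"]],
        goal_cases)
      case (4 a \<sigma>'')
      then have fr': "x \<notin> {''a'', ''j''} \<Longrightarrow> fst \<sigma>'' x = fst \<sigma>' x"
        "x \<notin> {''G'', ''W'', ''Z''} \<Longrightarrow> snd \<sigma>'' x = snd \<sigma>' x" for x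
        by (auto simp: frame_def upd_def)
      have w: "fst \<sigma>'' ''w'' [] \<le> S" using S(4) by (simp add: fr fr')
      show ?case
      proof (rule run_Seq[OF run_compute_gain[OF S(1) w]],
          rule run_Seq_eq[OF run_RAssign[OF S(1)]], rule run_weaken[OF run_RAssign[OF S(1)]], goal_cases)
        case (1 \<sigma>3 \<sigma>4)
        then have fr3: "x \<noteq> ''j'' \<Longrightarrow> fst \<sigma>3 x = fst \<sigma>'' x" "x \<noteq> ''G'' \<Longrightarrow> snd \<sigma>3 x = snd \<sigma>'' x" for x
          by (auto simp: frame_def)
        have G: "snd \<sigma>3 ''G'' [] = g a k"
          using 1(2) 4(3) \<open>fst \<sigma>' ''k'' [] = k\<close> by (simp add: g_def fr fr' cong: if_cong)
        show ?case
          using 1(4) 4 \<open>fst \<sigma>' ''k'' [] = k\<close> G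
          by (auto simp: fr fr' fr3 upd_def less_Suc_eq v_def)
      qed
    qed (use 4 in \<open>auto simp: frame_def upd_def fr less_Suc_eq\<close>)
  qed (auto simp: frame_def)
  then show ?thesis by simp
qed

lemma run_update_iterate:
  fixes \<sigma> :: state
  assumes S: "1 \<le> S" "fst \<sigma> ''K'' [] \<le> S" "fst \<sigma> ''f'' [] \<le> S"
  shows "run S (Suc (Suc e)) 10 update_iterate \<sigma> (\<lambda>\<sigma>'. \<forall>a<fst \<sigma> ''K'' []. \<forall>k<fst \<sigma> ''f'' [].
    snd \<sigma>' ''A'' [a, k] = snd \<sigma> ''A'' [a, k] + snd \<sigma> ''P'' [a, k] / real (fst \<sigma> ''m'' []) \<and>
    snd \<sigma>' ''P'' [a, k] = snd \<sigma> ''W'' [a, k] / snd \<sigma> ''Z'' [k])"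
    (is "run S _ 10 _ _ (\<lambda>\<sigma>'. \<forall>a<?K. \<forall>k<?f. ?new \<sigma>' a k)")
proof -
  define old where "old \<sigma>' a k \<longleftrightarrow> snd \<sigma>' ''A'' [a, k] = snd \<sigma> ''A'' [a, k] \<and>
    snd \<sigma>' ''P'' [a, k] = snd \<sigma> ''P'' [a, k]" for \<sigma>' :: state and a k
  \<comment> \<open>The update happens in place, so the invariant also records that cells not yet
    reached keep their old values. Cells are reached in lexicographic order of row and
    column.\<close>
  define I where "I a k \<sigma>' \<longleftrightarrow> (\<forall>a' k'. if a' < a \<and> k' < ?f \<or> a' = a \<and> k' < k then ?new \<sigma>' a' k' else old \<sigma>' a' k')"
    for a k \<sigma>'
  have "run S (Suc (Suc e)) (((1 + 1) + 4) + 4) update_iterate \<sigma> (\<lambda>\<sigma>'. I ?K 0 \<sigma>')"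
    unfolding update_iterate_def
  proof (rule run_For[OF S(1,2)], goal_cases)
    case (4 a \<sigma>')
    then have fr: "x \<notin> {''a'', ''k''} \<Longrightarrow> fst \<sigma>' x = fst \<sigma> x" "x \<notin> {''A'', ''P''} \<Longrightarrow> snd \<sigma>' x = snd \<sigma> x" for x
      by (auto simp: frame_def)
    show ?case
    proof (rule run_weaken[OF run_For[OF S(1,3), where I = "I a"]], goal_cases)
      case (4 k \<sigma>'')
      then have fr': "x \<noteq> ''k'' \<Longrightarrow> fst \<sigma>'' x = fst \<sigma>' x" "x \<notin> {''A'', ''P''} \<Longrightarrow> snd \<sigma>'' x = snd \<sigma>' x" for x
        by (auto simp: frame_def upd_def)
      have "old \<sigma>'' a k" using 4(4) by (auto simp: I_def split: if_splits)
      then show ?case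
        by (intro run_Seq_eq[OF run_RAssign[OF S(1)]] run_weaken[OF run_RAssign[OF S(1)]])
          (use 4(3,4) \<open>fst \<sigma>' ''a'' [] = a\<close> in
            \<open>auto simp: fr fr' upd_def I_def less_Suc_eq old_def split: if_splits\<close>)
    next
      case (5 \<sigma>'')
      \<comment> \<open>The end of row \<open>a\<close> is the beginning of row \<open>Suc a\<close>
        in this order.\<close>
      have "(a' < a \<and> k' < ?f \<or> a' = a \<and> k' < ?f) = (a' < Suc a \<and> k' < ?f \<or> a' = Suc a \<and> k' < 0)" for a' k'
        by auto
      then show ?case using 5(2) by (simp add: I_def old_def upd_def cong: if_cong)
    qed (use 4 in \<open>auto simp: frame_def upd_def fr I_def old_def cong: if_cong\<close>)
  qed (auto simp: frame_def I_def old_def upd_def cong: if_cong)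
  then have "run S (Suc (Suc e)) 10 update_iterate \<sigma> (I ?K 0)" by simp
  then show ?thesis by (rule run_weaken) (auto simp: I_def)
qed

lemma run_initialize:
  assumes S: "1 \<le> S" "fst \<sigma> ''K'' [] \<le> S" "fst \<sigma> ''f'' [] \<le> S"
  shows "run S (Suc (Suc e)) 10 initialize \<sigma> (\<lambda>\<sigma>'.
    snd \<sigma>' ''eta'' [] = snd \<sigma> ''eps'' [] / (2 * real (fst \<sigma> ''f'' []) * (real (fst \<sigma> ''w'' []))\<^sup>2) \<and>
    (\<forall>a<fst \<sigma> ''K'' []. \<forall>k<fst \<sigma> ''f'' []. snd \<sigma>' ''P'' [a, k] = 1 / real (fst \<sigma> ''K'' [])))"
    (is "run S _ 10 _ _ (\<lambda>\<sigma>'. snd \<sigma>' ''eta'' [] = ?eta \<and> (\<forall>a<?K. \<forall>k<?f. ?P \<sigma>' a k))")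
proof -
  have "run S (Suc (Suc e)) (1 + ((1 + 4) + 4)) initialize \<sigma> (\<lambda>\<sigma>'. snd \<sigma>' ''eta'' [] = ?eta \<and> (\<forall>a<?K. \<forall>k<?f. ?P \<sigma>' a k))"
    unfolding initialize_def
  proof (rule run_Seq_eq[OF run_RAssign[OF S(1)]],
      rule run_weaken[OF run_For[OF S(1,2), where I = "\<lambda>i \<sigma>'. \<forall>a<i. \<forall>k<?f. ?P \<sigma>' a k"]], goal_cases)
    case (4 a \<sigma>')
    then have fr: "x \<notin> {''a'', ''k''} \<Longrightarrow> fst \<sigma>' x = fst \<sigma> x" for x
      by (auto simp: frame_def)
    show ?case
    proof (rule run_weaken[OF run_For[OF S(1,3), where
          I = "\<lambda>i \<sigma>'. (\<forall>a'<a. \<forall>k<?f. ?P \<sigma>' a' k) \<and> (\<forall>k<i. ?P \<sigma>' a k)"]], goal_cases)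
      case (4 k \<sigma>'')
      then have fr': "x \<noteq> ''k'' \<Longrightarrow> fst \<sigma>'' x = fst \<sigma>' x" for x
        by (auto simp: frame_def)
      show ?case
        by (rule run_weaken[OF run_RAssign[OF S(1)]])
          (use 4(3,4) \<open>fst \<sigma>' ''a'' [] = a\<close> in \<open>auto simp: fr fr' upd_def less_Suc_eq\<close>)
    qed (use 4 in \<open>auto simp: frame_def upd_def fr less_Suc_eq\<close>)
  qed (auto simp: frame_def upd_def power2_eq_square)
  then show ?thesis by simp
qed

section \<open>The learner\<close>

lemma writes_stages [simp]:
  "nat_writes score_positions = {''j'', ''k''}" "real_writes score_positions = {''q''}"
  "nat_writes score_windows = {''i'', ''j''}" "real_writes score_windows = {''Q''}"
  "nat_writes find_worst = {''b'', ''i''}" "real_writes find_worst = {}"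
  "nat_writes compute_weights = {''k'', ''a'', ''j''}" "real_writes compute_weights = {''Z'', ''G'', ''W''}"
  "nat_writes update_iterate = {''a'', ''k''}" "real_writes update_iterate = {''A'', ''P''}"
  "nat_writes initialize = {''a'', ''k''}" "real_writes initialize = {''eta'', ''P''}"
  by (auto simp: score_positions_def score_windows_def find_worst_def compute_weights_def
      update_iterate_def initialize_def)

lemma writes_mw_round [simp]:
  "nat_writes mw_round = {''j'', ''k'', ''i'', ''b'', ''a''}"
  "real_writes mw_round = {''q'', ''Q'', ''Z'', ''G'', ''W'', ''A'', ''P''}"
  by (auto simp: mw_round_def)

text \<open>One step of \<open>mw\<close> under the numbering \<open>idx\<close>: injectivity turns
  the comparison of numbers into equality of points, and bijectivity turns sums over
  \<open>{..<card K}\<close> into sums over \<open>K\<close>. The exponent 3 comes from the loops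
  over columns, points and window positions in \<open>compute_weights\<close>.\<close>

lemma run_mw_round:
  fixes \<sigma> :: state
  assumes K: "finite K" and idx: "bij_betw idx K {..<card K}" and w: "w \<le> n"
    and x: "valid_sample K n f x"
    and S: "1 \<le> S" "n \<le> S" "f \<le> S" "card K \<le> S" "n - w + 1 \<le> S"
    and \<sigma>: "fst \<sigma> ''K'' [] = card K" "fst \<sigma> ''n'' [] = n" "fst \<sigma> ''w'' [] = w" "fst \<sigma> ''f'' [] = f"
      "fst \<sigma> ''t'' [] = t" "snd \<sigma> ''eta'' [] = \<eta>"
    and s: "\<And>j. j < n \<Longrightarrow> fst \<sigma> ''s'' [t, j] = idx (fst x j)"
    and F: "\<And>j k. j < n \<Longrightarrow> k < f \<Longrightarrow> snd \<sigma> ''F'' [t, j, k] = snd x j k"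
    and p: "\<And>a k. a \<in> K \<Longrightarrow> k < f \<Longrightarrow> snd \<sigma> ''P'' [idx a, k] = p a k"
  shows "run S 3 55 mw_round \<sigma> (\<lambda>\<sigma>'. \<forall>a\<in>K. \<forall>k<f.
    snd \<sigma>' ''A'' [idx a, k] = snd \<sigma> ''A'' [idx a, k] + p a k / real (fst \<sigma> ''m'' []) \<and>
    snd \<sigma>' ''P'' [idx a, k] = mw_weight \<eta> f w n x p a k / (\<Sum>b\<in>K. mw_weight \<eta> f w n x p b k))"
proof -
  have idx_less: "idx a < card K" if "a \<in> K" for a using idx that by (auto simp: bij_betw_def)
  have idx_eq: "idx a = idx b \<longleftrightarrow> a = b" if "a \<in> K" "b \<in> K" for a b
    using idx that by (auto simp: bij_betw_def inj_on_def)
  have "run S (Suc (Suc (Suc 0))) (10 + (10 + (7 + (18 + 10)))) mw_round \<sigma> (\<lambda>\<sigma>'. \<forall>a\<in>K. \<forall>k<f.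
    snd \<sigma>' ''A'' [idx a, k] = snd \<sigma> ''A'' [idx a, k] + p a k / real (fst \<sigma> ''m'' []) \<and>
    snd \<sigma>' ''P'' [idx a, k] = mw_weight \<eta> f w n x p a k / (\<Sum>b\<in>K. mw_weight \<eta> f w n x p b k))"
    unfolding mw_round_def
  proof (rule run_Seq[OF run_score_positions], goal_cases)
    case (4 \<sigma>1)
    then have fr1: "y \<notin> {''j'', ''k''} \<Longrightarrow> fst \<sigma>1 y = fst \<sigma> y" "y \<noteq> ''q'' \<Longrightarrow> snd \<sigma>1 y = snd \<sigma> y" for y
      by (auto simp: frame_def)
    have q: "snd \<sigma>1 ''q'' [j] = (\<Sum>k<f. snd x j k * p (fst x j) k)" if "j < n" for j
      using 4(2) that valid_sampleD(1)[OF x that] by (simp add: \<sigma> s F p)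
    show ?case
    proof (rule run_Seq[OF run_score_windows], goal_cases)
      case (4 \<sigma>2)
      then have fr2: "y \<notin> {''i'', ''j''} \<Longrightarrow> fst \<sigma>2 y = fst \<sigma>1 y" "y \<noteq> ''Q'' \<Longrightarrow> snd \<sigma>2 y = snd \<sigma>1 y" for y
        by (auto simp: frame_def)
      have Q: "snd \<sigma>2 ''Q'' [i] = score f w x p i" if "i < n - w + 1" for i
      proof -
        have "snd \<sigma>2 ''Q'' [i] = (\<Sum>j<w. snd \<sigma>1 ''q'' [i + j])"
          using 4(2) that by (simp add: \<sigma> fr1)
        also have "\<dots> = (\<Sum>j<w. \<Sum>k<f. snd x (i + j) k * p (fst x (i + j)) k)"
          using that w by (intro sum.cong refl q) auto
        also have "\<dots> = score f w x p i"
          unfolding score_def by (simp add: sum.atLeastLessThan_shift_0[of _ i "i + w"] atLeast0LessThan)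
        finally show ?thesis .
      qed
      show ?case
      proof (rule run_Seq[OF run_find_worst], goal_cases)
        case (3 \<sigma>3)
        then have fr3: "y \<notin> {''b'', ''i''} \<Longrightarrow> fst \<sigma>3 y = fst \<sigma>2 y" "snd \<sigma>3 y = snd \<sigma>2 y" for y
          by (auto simp: frame_def)
        define b where "b = worst_window f w n x p"
        have bw: "b + w \<le> n" using worst_window_le[of f w n x p] w by (simp add: b_def)
        have b: "fst \<sigma>3 ''b'' [] = b"
        proof -
          have "fst \<sigma>2 ''n'' [] - fst \<sigma>2 ''w'' [] + 1 = n - w + 1" by (simp add: \<sigma> fr1 fr2)
          then show ?thesis
            unfolding 3(2) b_def worst_window_def by (simp only:) (rule argmin_upto_cong[OF Q], auto)
        qed
        have g: "(\<Sum>j<w. if fst \<sigma>3 ''s'' [t, b + j] = idx a then snd \<sigma>3 ''F'' [t, b + j, k] else 0)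
            = gain w x b a k" if "a \<in> K" "k < f" for a k
        proof -
          have "(\<Sum>j<w. if fst \<sigma>3 ''s'' [t, b + j] = idx a then snd \<sigma>3 ''F'' [t, b + j, k] else 0)
            = (\<Sum>j<w. if fst x (b + j) = a then snd x (b + j) k else 0)"
            using bw that valid_sampleD(1)[OF x]
            by (intro sum.cong refl) (auto simp: fr1 fr2 fr3 s F idx_eq)
          then show ?thesis
            unfolding gain_def by (simp add: sum.atLeastLessThan_shift_0[of _ b "b + w"] atLeast0LessThan)
        qed
        show ?case
        proof (rule run_Seq[OF run_compute_weights], goal_cases)
          case (5 \<sigma>4)
          then have fr4: "y \<notin> {''k'', ''a'', ''j''} \<Longrightarrow> fst \<sigma>4 y = fst \<sigma>3 y"
            "y \<notin> {''Z'', ''G'', ''W''} \<Longrightarrow> snd \<sigma>4 y = snd \<sigma>3 y" for y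
            by (auto simp: frame_def)
          define v where "v a k = snd \<sigma>3 ''P'' [a, k] * (1 + snd \<sigma>3 ''eta'' [] * (\<Sum>j<w.
            if fst \<sigma>3 ''s'' [t, b + j] = a then snd \<sigma>3 ''F'' [t, b + j, k] else 0))" for a k
          have v: "v (idx a) k = mw_weight \<eta> f w n x p a k" if "a \<in> K" "k < f" for a k
            using that unfolding v_def g[OF that] by (simp add: fr1 fr2 fr3 p \<sigma> mw_weight_def b_def)
          have WZ: "\<forall>k<f. (\<forall>a<card K. snd \<sigma>4 ''W'' [a, k] = v a k) \<and> snd \<sigma>4 ''Z'' [k] = (\<Sum>a<card K. v a k)"
            using 5(2) by (simp add: fr1 fr2 fr3 \<sigma> b v_def cong: if_cong)
          have W: "snd \<sigma>4 ''W'' [idx a, k] = mw_weight \<eta> f w n x p a k" if "a \<in> K" "k < f" for a k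
            using WZ that idx_less by (simp add: v)
          have Z: "snd \<sigma>4 ''Z'' [k] = (\<Sum>b\<in>K. mw_weight \<eta> f w n x p b k)" if "k < f" for k
            using WZ that sum.reindex_bij_betw[OF idx, of "\<lambda>a. v a k"] by (simp add: v)
          show ?case
            by (rule run_weaken[OF run_update_iterate])
              (use S in \<open>auto simp: fr1 fr2 fr3 fr4 \<sigma> idx_less W Z p\<close>)
        qed (use S w in \<open>auto simp: fr1 fr2 fr3 \<sigma>\<close>)
      qed (use S in \<open>auto simp: fr1 fr2 \<sigma>\<close>)
    qed (use S w in \<open>auto simp: fr1 \<sigma>\<close>)
  qed (use S in \<open>auto simp: \<sigma>\<close>)
  then show ?thesis by (simp add: numeral_3_eq_3)
qed

lemma run_mw_program:
  assumes K: "finite K" "K \<noteq> {}" and idx: "bij_betw idx K {..<card K}" and w: "w \<le> n" "w > 0"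
    and valid: "\<And>t. t < m \<Longrightarrow> valid_sample K n f (z t)"
    and \<eta>: "\<eta> = \<epsilon> / (2 * real f * (real w)\<^sup>2)"
  shows "run (n + f + card K + m) 4 69 mw_program (input_state K idx w n f \<epsilon> \<delta> m z)
    (\<lambda>\<sigma>'. \<forall>a\<in>K. \<forall>k<f. snd \<sigma>' ''A'' [idx a, k] = mw_average \<eta> K f w n m z a k)"
proof -
  define \<sigma>0 where "\<sigma>0 = input_state K idx w n f \<epsilon> \<delta> m z"
  define S where "S = n + f + card K + m"
  \<comment> \<open>\<open>S\<close> dominates every loop bound; \<open>n - w + 1 \<le> n\<close>
    uses \<open>w > 0\<close>.\<close>
  have S: "1 \<le> S" "n \<le> S" "f \<le> S" "card K \<le> S" "m \<le> S" "n - w + 1 \<le> S"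
    using w by (auto simp: S_def)
  have idx_less: "idx a < card K" if "a \<in> K" for a using idx that by (auto simp: bij_betw_def)
  have \<sigma>0: "fst \<sigma>0 ''K'' [] = card K" "fst \<sigma>0 ''n'' [] = n" "fst \<sigma>0 ''w'' [] = w" "fst \<sigma>0 ''f'' [] = f"
    "fst \<sigma>0 ''m'' [] = m" "snd \<sigma>0 ''eps'' [] = \<epsilon>" "snd \<sigma>0 ''A'' [i, k] = 0"
    "t < m \<Longrightarrow> j < n \<Longrightarrow> fst \<sigma>0 ''s'' [t, j] = idx (fst (z t) j)"
    "t < m \<Longrightarrow> j < n \<Longrightarrow> k < f \<Longrightarrow> snd \<sigma>0 ''F'' [t, j, k] = snd (z t) j k" for i t j k
    by (simp_all add: \<sigma>0_def input_state_def)
  let ?A = "mw \<eta> K f w n z"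
  have "run S (Suc 3) (10 + (55 + 4)) mw_program \<sigma>0
    (\<lambda>\<sigma>'. \<forall>a\<in>K. \<forall>k<f. snd \<sigma>' ''P'' [idx a, k] = ?A m a k \<and> snd \<sigma>' ''A'' [idx a, k] = (\<Sum>t<m. ?A t a k / real m))"
    unfolding mw_program_def
  proof (rule run_Seq)
    show "run S (Suc 3) 10 initialize \<sigma>0 (\<lambda>\<sigma>'.
      snd \<sigma>' ''eta'' [] = snd \<sigma>0 ''eps'' [] / (2 * real (fst \<sigma>0 ''f'' []) * (real (fst \<sigma>0 ''w'' []))\<^sup>2) \<and>
      (\<forall>a<fst \<sigma>0 ''K'' []. \<forall>k<fst \<sigma>0 ''f'' []. snd \<sigma>' ''P'' [a, k] = 1 / real (fst \<sigma>0 ''K'' [])))"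
      using run_initialize[of S \<sigma>0 2] S \<sigma>0 by (simp add: numeral_3_eq_3)
  next
    fix \<sigma>1 assume 1: "frame initialize \<sigma>0 \<sigma>1"
      "snd \<sigma>1 ''eta'' [] = snd \<sigma>0 ''eps'' [] / (2 * real (fst \<sigma>0 ''f'' []) * (real (fst \<sigma>0 ''w'' []))\<^sup>2) \<and>
      (\<forall>a<fst \<sigma>0 ''K'' []. \<forall>k<fst \<sigma>0 ''f'' []. snd \<sigma>1 ''P'' [a, k] = 1 / real (fst \<sigma>0 ''K'' []))"
    have fr1: "y \<notin> {''a'', ''k''} \<Longrightarrow> fst \<sigma>1 y = fst \<sigma>0 y" "y \<notin> {''eta'', ''P''} \<Longrightarrow> snd \<sigma>1 y = snd \<sigma>0 y" for y
      using 1(1) by (auto simp: frame_def)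
    have eta: "snd \<sigma>1 ''eta'' [] = \<eta>" using 1(2) by (simp add: \<sigma>0 \<eta>)
    show "run S (Suc 3) (55 + 4) (For ''t'' (Nat ''m'') mw_round) \<sigma>1
      (\<lambda>\<sigma>'. \<forall>a\<in>K. \<forall>k<f. snd \<sigma>' ''P'' [idx a, k] = ?A m a k \<and> snd \<sigma>' ''A'' [idx a, k] = (\<Sum>t<m. ?A t a k / real m))"
    proof (rule run_For[OF S(1,5), where I = "\<lambda>t \<sigma>'. \<forall>a\<in>K. \<forall>k<f. snd \<sigma>' ''P'' [idx a, k] = ?A t a k \<and>
          snd \<sigma>' ''A'' [idx a, k] = (\<Sum>\<tau><t. ?A \<tau> a k / real m)"], goal_cases)
      case (4 t \<sigma>')
      then have fr: "y \<notin> {''t'', ''j'', ''k'', ''i'', ''b'', ''a''} \<Longrightarrow> fst \<sigma>' y = fst \<sigma>1 y"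
        "y \<notin> {''q'', ''Q'', ''Z'', ''G'', ''W'', ''A'', ''P''} \<Longrightarrow> snd \<sigma>' y = snd \<sigma>1 y" for y
        by (auto simp: frame_def)
      show ?case
        by (rule run_weaken[OF run_mw_round[where p = "?A t" and x = "z t" and t = t and K = K and idx = idx
              and n = n and w = w and f = f and \<eta> = \<eta>]])
          (use 4 S K idx w valid in \<open>auto simp: fr fr1 \<sigma>0 eta upd_def\<close>)
    qed (use 1(2) in \<open>auto simp: frame_def \<sigma>0 fr1 upd_def idx_less\<close>)
  qed
  then have "run S 4 69 mw_program \<sigma>0 (\<lambda>\<sigma>'. \<forall>a\<in>K. \<forall>k<f. snd \<sigma>' ''A'' [idx a, k] = mw_average \<eta> K f w n m z a k)"
    by simp (erule run_weaken, auto simp: mw_average_def sum_divide_distrib)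
  then show ?thesis by (simp add: S_def \<sigma>0_def)
qed

lemma le_sample_size: "C * ((\<gamma> * D / \<epsilon>)\<^sup>2 * ((real n)\<^sup>2 * (real f)\<^sup>2 * ln (real N) + ln (1 / \<delta>)))
    \<le> real (sample_size C \<gamma> D n f N \<epsilon> \<delta>)"
  unfolding sample_size_def by linarith

lemma mw_learner:
  fixes K :: "'k set"
  assumes "setting K d D \<gamma> w n" and idx: "bij_betw idx K {..<card K}" and \<epsilon>: "\<epsilon> > 0" and \<delta>: "\<delta> > 0"
    and \<D>: "prob_space \<D>" "sets \<D> = sets (sample_space K n f)"
    and m_eq: "m = sample_size 32 \<gamma> D n f (card K) \<epsilon> \<delta>"
  shows "\<exists>(A_hat :: (nat \<Rightarrow> 'k sample) \<Rightarrow> 'k \<Rightarrow> nat \<Rightarrow> real) A_opt.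
             (\<forall>z \<in> space (\<Pi>\<^sub>M i\<in>{..<m}. \<D>).
                \<exists>t \<sigma>. exec mw_program (input_state K idx w n f \<epsilon> \<delta> m z) t \<sigma> \<and>
                      t \<le> 69 * (n + f + card K + m) ^ 4 \<and>
                      A_hat z = output_matrix idx \<sigma> \<and>
                      A_hat z \<in> stoch K {..<f}) \<and>
             is_arg_min (risk K w n f \<D>) (\<lambda>A. A \<in> stoch K {..<f}) A_opt \<and>
             \<P>(z in (\<Pi>\<^sub>M i\<in>{..<m}. \<D>). risk K w n f \<D> (A_hat z) \<le> risk K w n f \<D> A_opt + \<epsilon>)
               \<ge> 1 - \<delta>"
proof -
  have K: "finite K" "K \<noteq> {}" and w: "real w = \<gamma> * D" "w \<le> n" "w > 0"
    using assms(1) by (auto simp: setting_def)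
  let ?M = "\<Pi>\<^sub>M i\<in>{..<m}. \<D>"
  let ?R = "risk K w n f \<D>"
  define \<eta> where "\<eta> = \<epsilon> / (2 * real f * (real w)\<^sup>2)"
  have m: "m > 0" by (simp add: m_eq sample_size_def)
  have valid: "valid_sample K n f x" if "x \<in> space \<D>" for x
    by (rule valid_sample_space[OF K w(2,3) \<D> that])
  obtain x where "x \<in> space \<D>" using prob_space.not_empty[OF \<D>(1)] by blast
  \<comment> \<open>The sample space is nonempty, and a feature row of length 0 could not sum to
    one.\<close>
  from valid_sampleD(3)[OF valid[OF this], of 0] w have f: "f > 0" by (cases f) auto
  have \<eta>: "\<eta> > 0" using \<epsilon> f w(3) by (simp add: \<eta>_def)
  obtain A_opt where opt: "is_arg_min ?R (\<lambda>A. A \<in> stoch K {..<f}) A_opt"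
    using risk_attains_min[OF K w(2,3) \<D>] by blast
  have "\<exists>\<sigma>. (\<exists>t. exec mw_program (input_state K idx w n f \<epsilon> \<delta> m z) t \<sigma> \<and> t \<le> 69 * (n + f + card K + m) ^ 4) \<and>
      (\<forall>a\<in>K. \<forall>k<f. output_matrix idx \<sigma> a k = mw_average \<eta> K f w n m z a k) \<and> output_matrix idx \<sigma> \<in> stoch K {..<f}"
    if z: "z \<in> space ?M" for z
  proof -
    have z_valid: "valid_sample K n f (z t)" if "t < m" for t
      using z that by (intro valid) (auto simp: space_PiM)
    obtain t \<sigma> where \<sigma>: "exec mw_program (input_state K idx w n f \<epsilon> \<delta> m z) t \<sigma>"
      "t \<le> 69 * (n + f + card K + m) ^ 4"
      "\<forall>a\<in>K. \<forall>k<f. output_matrix idx \<sigma> a k = mw_average \<eta> K f w n m z a k"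
      using run_mw_program[where z = z and \<delta> = \<delta>, OF K idx w(2,3) z_valid \<eta>_def]
      unfolding run_def output_matrix_def by blast
    moreover have "output_matrix idx \<sigma> \<in> stoch K {..<f}"
      using mw_average_in_stoch[OF K w(2,3) \<D> m \<eta> z_valid] \<sigma>(3) by (simp add: stoch_def)
    ultimately show ?thesis by blast
  qed
  \<comment> \<open>The final state is chosen separately for each sample vector. The output
    therefore carries no measurability of its own, and its success event is later identified with
    that of \<open>mw_average\<close>.\<close>
  then obtain \<Sigma> where \<Sigma>: "z \<in> space ?M \<Longrightarrow>
      \<exists>t. exec mw_program (input_state K idx w n f \<epsilon> \<delta> m z) t (\<Sigma> z) \<and> t \<le> 69 * (n + f + card K + m) ^ 4"
    "z \<in> space ?M \<Longrightarrow> a \<in> K \<Longrightarrow> k < f \<Longrightarrow> output_matrix idx (\<Sigma> z) a k = mw_average \<eta> K f w n m z a k"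
    "z \<in> space ?M \<Longrightarrow> output_matrix idx (\<Sigma> z) \<in> stoch K {..<f}" for z a k
    by metis
  define A_hat where "A_hat z = output_matrix idx (\<Sigma> z)" for z
  have "1 - \<delta> \<le> \<P>(z in ?M. ?R (mw_average \<eta> K f w n m z) \<le> ?R A_opt + \<epsilon>)"
  \<comment> \<open>For \<open>\<delta> \<le> 1\<close> both summands of the sample size are
    nonnegative, so each is bounded by \<open>m\<close> separately. Otherwise
    \<open>1 - \<delta>\<close> is negative.\<close>
  proof (cases "\<delta> \<le> 1")
    case True
    define L where "L = ln (real (card K))"
    have L: "0 \<le> L" using K by (simp add: L_def card_gt_0_iff Suc_le_eq)
    have ln_\<delta>: "0 \<le> ln (1 / \<delta>)" using True \<delta> by simp
    have n: "1 \<le> (real n)\<^sup>2" using w by simp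
    \<comment> \<open>As \<open>n \<ge> 1\<close>, the sample size covers both requirements of
      \<open>mw_average_generalizes\<close>, with constants 8 for the regret and 32 for the
      deviation.\<close>
    have "32 * ((real w / \<epsilon>)\<^sup>2 * ((real f)\<^sup>2 * L + ln (1 / \<delta>)))
        \<le> 32 * ((real w / \<epsilon>)\<^sup>2 * ((real n)\<^sup>2 * (real f)\<^sup>2 * L + ln (1 / \<delta>)))"
      using L mult_right_mono[OF n, of "(real f)\<^sup>2 * L"] by (intro mult_left_mono) (auto simp: mult.assoc)
    also have "\<dots> \<le> real m" using le_sample_size[of 32 \<gamma> D] by (simp add: m_eq w(1) L_def)
    finally have *: "32 * ((real w / \<epsilon>)\<^sup>2 * ((real f)\<^sup>2 * L)) + 32 * ((real w / \<epsilon>)\<^sup>2 * ln (1 / \<delta>)) \<le> real m"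
      by (simp add: distrib_left)
    have "0 \<le> (real w / \<epsilon>)\<^sup>2 * ((real f)\<^sup>2 * L)" "0 \<le> (real w / \<epsilon>)\<^sup>2 * ln (1 / \<delta>)"
      using L ln_\<delta> by (intro mult_nonneg_nonneg; simp)+
    with * have "8 * (real w / \<epsilon>)\<^sup>2 * ((real f)\<^sup>2 * L) \<le> real m" "32 * (real w / \<epsilon>)\<^sup>2 * ln (1 / \<delta>) \<le> real m"
      unfolding mult.assoc by linarith+
    then show ?thesis
      using opt by (intro mw_average_generalizes[OF K w(2,3) \<D> \<epsilon> \<delta> m f])
        (auto simp: L_def \<eta>_def is_arg_min_def)
  next
    case False
    then show ?thesis by (simp add: order_trans[OF _ measure_nonneg])
  qed
  also have "{z \<in> space ?M. ?R (mw_average \<eta> K f w n m z) \<le> ?R A_opt + \<epsilon>} = {z \<in> space ?M. ?R (A_hat z) \<le> ?R A_opt + \<epsilon>}"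
  proof -
    have "?R (A_hat z) = ?R (mw_average \<eta> K f w n m z)" if "z \<in> space ?M" for z
      using \<Sigma>(2)[OF that] by (intro risk_cong[OF K w(2,3) \<D>]) (simp add: A_hat_def)
    then show ?thesis by auto
  qed
  finally have prob: "1 - \<delta> \<le> \<P>(z in ?M. ?R (A_hat z) \<le> ?R A_opt + \<epsilon>)" .
  have "\<forall>z\<in>space ?M. \<exists>t \<sigma>. exec mw_program (input_state K idx w n f \<epsilon> \<delta> m z) t \<sigma> \<and>
      t \<le> 69 * (n + f + card K + m) ^ 4 \<and> A_hat z = output_matrix idx \<sigma> \<and> A_hat z \<in> stoch K {..<f}"
    unfolding A_hat_def using \<Sigma>(1,3) by blast
  with opt prob show ?thesis by blast
qed

theorem theoremC3:
  shows
    "(\<exists>(C::real) (P::com) (c::nat) (e::nat). C > 0 \<and>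
       (\<forall>(K::'k set) d D \<gamma> w n f idx \<epsilon> \<delta> \<D> m.
          setting K d D \<gamma> w n \<and> bij_betw idx K {..<card K} \<and> \<epsilon> > 0 \<and> \<delta> > 0 \<and>
          prob_space \<D> \<and> sets \<D> = sets (sample_space K n f) \<and>
          m = sample_size C \<gamma> D n f (card K) \<epsilon> \<delta> \<longrightarrow>
          (\<exists>(A_hat :: (nat \<Rightarrow> 'k sample) \<Rightarrow> 'k \<Rightarrow> nat \<Rightarrow> real) A_opt.
             (\<forall>z \<in> space (\<Pi>\<^sub>M i\<in>{..<m}. \<D>).
                \<exists>t \<sigma>. exec P (input_state K idx w n f \<epsilon> \<delta> m z) t \<sigma> \<and>
                      t \<le> c * (n + f + card K + m) ^ e \<and>
                      A_hat z = output_matrix idx \<sigma> \<and>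
                      A_hat z \<in> stoch K {..<f}) \<and>
             is_arg_min (risk K w n f \<D>) (\<lambda>A. A \<in> stoch K {..<f}) A_opt \<and>
             \<P>(z in (\<Pi>\<^sub>M i\<in>{..<m}. \<D>). risk K w n f \<D> (A_hat z) \<le> risk K w n f \<D> A_opt + \<epsilon>)
               \<ge> 1 - \<delta>)))
     \<and>
     (\<forall>(K::'k set) d D \<gamma> w n f T.
        setting K d D \<gamma> w n \<longrightarrow>
        (\<exists>\<alpha>>0. \<forall>(s :: nat \<Rightarrow> nat \<Rightarrow> 'k) F g.
           (\<forall>t<T. s t \<in> {..<n} \<rightarrow> K \<and> transpose_fun (F t) \<in> stoch {..<f} {..<n}) \<and>
           (\<forall>t<T. is_subgradient K f (\<lambda>A. U K w n (s t) (predict f (F t) A)) (eg \<alpha> K g t) (g t)) \<longrightarrow>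
           (\<exists>A_opt. is_arg_max (regret K w n f T s F (eg \<alpha> K g)) (\<lambda>A. A \<in> stoch K {..<f}) A_opt \<and>
                    regret K w n f T s F (eg \<alpha> K g) A_opt
                      \<le> \<gamma> * D * real f * sqrt (2 * real T * ln (real (card K))))))"
proof (rule conjI, goal_cases)
  case 1
  show ?case
  \<comment> \<open>The step bound \<open>69 * S ^ 4\<close> is that of
    \<open>run_mw_program\<close>: 10 for the initialization and \<open>55 + 4\<close> for the loop
    over the samples around a cubic round.\<close>
  proof (rule exI[of _ 32], rule exI[of _ mw_program], rule exI[of _ 69], rule exI[of _ 4],
      intro conjI allI impI, goal_cases)
    case (2 K d D \<gamma> w n f idx \<epsilon> \<delta> \<D> m)
    then show ?case by (elim conjE) (rule mw_learner)
  qed simp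
next
  case 2
  show ?case by (intro allI impI) (rule eg_regret_bound)
qed

end
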